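(* Let $\mathcal A$ be a finite alphabet, let $\Omega=\mathcal A^{\mathbb N}$ and let $T:\Omega\to\Omega$ be the shift. Let $A=(A_n)_{n\ge 0}$ be a decreasing sequence of positive real numbers with $A_n\to 0$ and $A_{n+1}/A_n\to 0$ as $n\to\infty$. For each periodic point $y\in\Omega$, let $$P_y=\{f\in C_A(\Omega): \mu_y \text{ is the unique maximizing measure for } f\},$$ and let $(P_y)^\circ$ denote the interior of $P_y$ in $C_A(\Omega)$ with respect to the topology of the norm $\|\cdot\|_A$. Then $$\bigcup_{y\text{ periodic}}(P_y)^\circ$$ is dense in $C_A(\Omega)$ with respect to the topology of the norm $\|\cdot\|_A$.
   Context: $\mathbb N$ includes $0$. $\Omega=\mathcal A^{\mathbb N}$ is the space of one-sided infinite sequences $x=(x)_0(x)_1(x)_2\cdots$ over $\mathcal A$, and $T$ is the shift, $(Tx)_i=(x)_{i+1}$. The metric $d_A$ on $\Omega$ is defined by $d_A(x,x)=0$ and $d_A(x,y)=A_n$ if $x$ and $y$ first differ in the $n$th place, i.e. $(x)_i=(y)_i$ for $0\le i<n$ and $(x)_n\neq(y)_n$. $C_A(\Omega)$ is the space of real-valued functions on $\Omega$ that are Lipschitz with respect to $d_A$, with norm $\|f\|_A=\mathrm{Lip}_A(f)+\|f\|_\infty$, where $\mathrm{Lip}_A(f)=\sup_{k\ge 0}\mathrm{var}_k(f)/A_k$ and $\mathrm{var}_k(f)=\sup\{|f(x)-f(y)|: (x)_i=(y)_i \text{ for } 0\le i<k\}$. A point $y$ is periodic if $T^iy=y$ for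 some $i\ge 1$; then $\mu_y$ denotes the unique $T$-invariant Borel probability measure supported on the (finite) orbit of $y$ (a periodic orbit measure). A $T$-invariant Borel probability measure $\mu$ is a maximizing measure for (optimizes) $f$ if $\int f\,d\mu\ge\int f\,d\nu$ for every $T$-invariant Borel probability measure $\nu$ on $\Omega$. *)

theory Defs
  imports "HOL-Probability.Probability"
begin

section \<open>The one-sided full shift\<close>

definition full_shift :: "(nat \<Rightarrow> 'a) \<Rightarrow> nat \<Rightarrow> 'a" where
  "full_shift x = (\<lambda>i. x (Suc i))"

definition periodic :: "(nat \<Rightarrow> 'a) \<Rightarrow> bool" where
  "periodic y \<longleftrightarrow> (\<exists>i\<ge>1. (full_shift ^^ i) y = y)"

definition orbit :: "(nat \<Rightarrow> 'a) \<Rightarrow> (nat \<Rightarrow> 'a) set" where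
  "orbit y = (\<lambda>i. (full_shift ^^ i) y) ` UNIV"

section \<open>Invariant measures\<close>

text \<open>The alphabet carries no topological type class, so the Borel sigma-algebra is generated
  from the product of the discrete topologies. This is also the topology of the metric
  \<open>seq_dist A\<close> below when \<open>A\<close> is positive and decreases to 0.\<close>

definition seq_borel :: "(nat \<Rightarrow> 'a) measure" where
  "seq_borel = sigma UNIV {U. openin (product_topology (\<lambda>_. discrete_topology UNIV) UNIV) U}"

definition invariant_prob :: "(nat \<Rightarrow> 'a) measure \<Rightarrow> bool" where
  "invariant_prob \<mu> \<longleftrightarrow> sets \<mu> = sets seq_borel \<and> prob_space \<mu> \<and> distr \<mu> \<mu> full_shift = \<mu>"

definition orbit_measure :: "(nat \<Rightarrow> 'a) \<Rightarrow> (nat \<Rightarrow> 'a) measure" where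
  "orbit_measure y = (THE \<mu>. invariant_prob \<mu> \<and> measure \<mu> (orbit y) = 1)"

definition maximizing :: "((nat \<Rightarrow> 'a) \<Rightarrow> real) \<Rightarrow> (nat \<Rightarrow> 'a) measure \<Rightarrow> bool" where
  "maximizing f \<mu> \<longleftrightarrow> invariant_prob \<mu> \<and>
     (\<forall>\<nu>. invariant_prob \<nu> \<longrightarrow> integral\<^sup>L \<nu> f \<le> integral\<^sup>L \<mu> f)"

section \<open>The space of Lipschitz functions\<close>

definition seq_dist :: "(nat \<Rightarrow> real) \<Rightarrow> (nat \<Rightarrow> 'a) \<Rightarrow> (nat \<Rightarrow> 'a) \<Rightarrow> real" where
  "seq_dist A x y = (if x = y then 0 else A (LEAST n. x n \<noteq> y n))"

definition lip_space :: "(nat \<Rightarrow> real) \<Rightarrow> ((nat \<Rightarrow> 'a) \<Rightarrow> real) set" where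
  "lip_space A = {f. \<exists>C. \<forall>x y. \<bar>f x - f y\<bar> \<le> C * seq_dist A x y}"

text \<open>The real-valued suprema below are over nonempty sets; the lemmas further down show that
  they are bounded above for the functions in \<open>lip_space A\<close>.\<close>

definition variation :: "nat \<Rightarrow> ((nat \<Rightarrow> 'a) \<Rightarrow> real) \<Rightarrow> real" where
  "variation k f = Sup {\<bar>f x - f y\<bar> | x y. \<forall>i<k. x i = y i}"

definition lip_const :: "(nat \<Rightarrow> real) \<Rightarrow> ((nat \<Rightarrow> 'a) \<Rightarrow> real) \<Rightarrow> real" where
  "lip_const A f = (SUP k. variation k f / A k)"

definition sup_norm :: "((nat \<Rightarrow> 'a) \<Rightarrow> real) \<Rightarrow> real" where
  "sup_norm f = (SUP x. \<bar>f x\<bar>)"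

definition lip_norm :: "(nat \<Rightarrow> real) \<Rightarrow> ((nat \<Rightarrow> 'a) \<Rightarrow> real) \<Rightarrow> real" where
  "lip_norm A f = lip_const A f + sup_norm f"

text \<open>The locale \<open>Metric_space\<close> requires nonnegativity also outside the carrier, where the suprema in
  \<open>lip_norm\<close> may be unbounded; hence the value 0 there.\<close>

definition lip_dist ::
    "(nat \<Rightarrow> real) \<Rightarrow> ((nat \<Rightarrow> 'a) \<Rightarrow> real) \<Rightarrow> ((nat \<Rightarrow> 'a) \<Rightarrow> real) \<Rightarrow> real" where
  "lip_dist A f g =
     (if f \<in> lip_space A \<and> g \<in> lip_space A then lip_norm A (\<lambda>x. f x - g x) else 0)"

definition lip_topology :: "(nat \<Rightarrow> real) \<Rightarrow> ((nat \<Rightarrow> 'a) \<Rightarrow> real) topology" where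
  "lip_topology A = Metric_space.mtopology (lip_space A) (lip_dist A)"

definition uniquely_optimized ::
    "(nat \<Rightarrow> real) \<Rightarrow> (nat \<Rightarrow> 'a) \<Rightarrow> ((nat \<Rightarrow> 'a) \<Rightarrow> real) set" where
  "uniquely_optimized A y = {f \<in> lip_space A. {\<mu>. maximizing f \<mu>} = {orbit_measure y}}"

section \<open>Well-definedness\<close>

lemma seq_dist_le:
  assumes "\<And>n. A n > 0" "decseq A" "\<forall>i<k. x i = y i"
  shows "0 \<le> seq_dist A x y" "seq_dist A x y \<le> A k"
proof -
  have "A (LEAST n. x n \<noteq> y n) \<le> A k" if neq: "x \<noteq> y"
  proof (rule decseqD[OF assms(2)])
    obtain n where "x n \<noteq> y n" using neq by (auto simp: fun_eq_iff)
    then have "x (LEAST n. x n \<noteq> y n) \<noteq> y (LEAST n. x n \<noteq> y n)" by (rule LeastI)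
    then show "k \<le> (LEAST n. x n \<noteq> y n)" using assms(3) not_le by blast
  qed
  then show "0 \<le> seq_dist A x y" "seq_dist A x y \<le> A k"
    using assms(1)[THEN less_imp_le] by (simp_all add: seq_dist_def)
qed

lemma lip_spaceE:
  fixes f :: "(nat \<Rightarrow> 'a) \<Rightarrow> real"
  assumes "\<And>n. A n > 0" "decseq A" "f \<in> lip_space A"
  obtains C where "\<And>k x y. \<forall>i<k. x i = y i \<Longrightarrow> \<bar>f x - f y\<bar> \<le> C * A k"
proof -
  obtain C where C: "\<And>x y. \<bar>f x - f y\<bar> \<le> C * seq_dist A x y"
    using assms(3) by (auto simp: lip_space_def)
  have "\<bar>f x - f y\<bar> \<le> \<bar>C\<bar> * A k" if "\<forall>i<k. x i = y i" for k x y
  proof -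
    note d = seq_dist_le[where A = A, OF assms(1,2) that]
    have "\<bar>f x - f y\<bar> \<le> \<bar>C\<bar> * seq_dist A x y"
      using C[of x y] mult_right_mono[OF abs_ge_self[of C] d(1)] by linarith
    also have "\<dots> \<le> \<bar>C\<bar> * A k" using d(2) by (simp add: mult_left_mono)
    finally show ?thesis .
  qed
  then show ?thesis using that by blast
qed

lemma variation_bdd:
  fixes f :: "(nat \<Rightarrow> 'a) \<Rightarrow> real"
  assumes "\<And>n. A n > 0" "decseq A" "f \<in> lip_space A"
  shows "bdd_above {\<bar>f x - f y\<bar> | x y. \<forall>i<k. x i = y i}"
proof -
  obtain C where C: "\<And>k x y. \<forall>i<k. x i = y i \<Longrightarrow> \<bar>f x - f y\<bar> \<le> C * A k"
    using lip_spaceE[OF assms] by metis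
  show ?thesis by (rule bdd_aboveI[of _ "C * A k"]) (use C in auto)
qed

lemma lip_const_bdd:
  fixes f :: "(nat \<Rightarrow> 'a) \<Rightarrow> real"
  assumes "\<And>n. A n > 0" "decseq A" "f \<in> lip_space A"
  shows "bdd_above (range (\<lambda>k. variation k f / A k))"
proof -
  obtain C where C: "\<And>k x y. \<forall>i<k. x i = y i \<Longrightarrow> \<bar>f x - f y\<bar> \<le> C * A k"
    using lip_spaceE[OF assms] by metis
  have "variation k f \<le> C * A k" for k
    unfolding variation_def by (rule cSup_least) (use C in auto)
  then have "variation k f / A k \<le> C" for k
    using assms(1)[of k] by (simp add: pos_divide_le_eq)
  then show ?thesis by (intro bdd_aboveI[of _ C]) auto
qed

lemma sup_norm_bdd:
  fixes f :: "(nat \<Rightarrow> 'a) \<Rightarrow> real"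
  assumes "\<And>n. A n > 0" "decseq A" "f \<in> lip_space A"
  shows "bdd_above (range (\<lambda>x. \<bar>f x\<bar>))"
proof -
  obtain C where C: "\<And>k x y. \<forall>i<k. x i = y i \<Longrightarrow> \<bar>f x - f y\<bar> \<le> C * A k"
    using lip_spaceE[OF assms] by metis
  have "\<bar>f x\<bar> \<le> \<bar>f undefined\<bar> + C * A 0" for x
    using C[of 0 x undefined] by auto
  then show ?thesis by (intro bdd_aboveI[of _ "\<bar>f undefined\<bar> + C * A 0"]) auto
qed

lemma variation_ge:
  fixes f :: "(nat \<Rightarrow> 'a) \<Rightarrow> real"
  assumes "\<And>n. A n > 0" "decseq A" "f \<in> lip_space A" "\<forall>i<k. x i = y i"
  shows "\<bar>f x - f y\<bar> \<le> variation k f"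
  unfolding variation_def
  by (rule cSup_upper[OF _ variation_bdd[OF assms(1-3)]]) (use assms(4) in auto)

lemma lip_const_ge:
  fixes f :: "(nat \<Rightarrow> 'a) \<Rightarrow> real"
  assumes "\<And>n. A n > 0" "decseq A" "f \<in> lip_space A"
  shows "variation k f / A k \<le> lip_const A f"
  unfolding lip_const_def by (rule cSUP_upper[OF UNIV_I lip_const_bdd[OF assms]])

lemma sup_norm_ge:
  fixes f :: "(nat \<Rightarrow> 'a) \<Rightarrow> real"
  assumes "\<And>n. A n > 0" "decseq A" "f \<in> lip_space A"
  shows "\<bar>f x\<bar> \<le> sup_norm f"
  unfolding sup_norm_def by (rule cSUP_upper[OF UNIV_I sup_norm_bdd[OF assms]])

lemma lip_const_nonneg:
  fixes f :: "(nat \<Rightarrow> 'a) \<Rightarrow> real"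
  assumes "\<And>n. A n > 0" "decseq A" "f \<in> lip_space A"
  shows "0 \<le> lip_const A f"
proof -
  have "0 \<le> variation 0 f / A 0"
    using variation_ge[OF assms, of 0 undefined undefined] assms(1)[of 0] by simp
  then show ?thesis using lip_const_ge[OF assms, of 0] by linarith
qed

lemma lip_norm_eq_0_iff:
  fixes f :: "(nat \<Rightarrow> 'a) \<Rightarrow> real"
  assumes "\<And>n. A n > 0" "decseq A" "f \<in> lip_space A"
  shows "lip_norm A f = 0 \<longleftrightarrow> f = (\<lambda>_. 0)"
proof
  assume "lip_norm A f = 0"
  then have "sup_norm f \<le> 0"
    using lip_const_nonneg[OF assms] by (simp add: lip_norm_def)
  then have "\<bar>f x\<bar> \<le> 0" for x using sup_norm_ge[OF assms, of x] by linarith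
  then show "f = (\<lambda>_. 0)" by auto
next
  assume f: "f = (\<lambda>_. 0)"
  have "{\<bar>f x - f y\<bar> | x y. \<forall>i<k. x i = y i} = {0}" for k using f by auto
  then show "lip_norm A f = 0"
    by (simp add: lip_norm_def lip_const_def sup_norm_def variation_def f)
qed

lemma lip_space_diff:
  assumes "f \<in> lip_space A" "g \<in> lip_space A"
  shows "(\<lambda>x. f x - g x) \<in> lip_space A"
proof -
  obtain C D where "\<And>x y. \<bar>f x - f y\<bar> \<le> C * seq_dist A x y" "\<And>x y. \<bar>g x - g y\<bar> \<le> D * seq_dist A x y"
    using assms by (auto simp: lip_space_def)
  then have "\<bar>(f x - g x) - (f y - g y)\<bar> \<le> (C + D) * seq_dist A x y" for x y
    by (smt (verit, best) distrib_right)
  then show ?thesis by (auto simp: lip_space_def)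
qed

lemma lip_norm_triangle:
  fixes f g :: "(nat \<Rightarrow> 'a) \<Rightarrow> real"
  assumes "\<And>n. A n > 0" "decseq A" "f \<in> lip_space A" "g \<in> lip_space A"
  shows "lip_norm A (\<lambda>x. f x + g x) \<le> lip_norm A f + lip_norm A g"
proof -
  have "variation k (\<lambda>x. f x + g x) \<le> variation k f + variation k g" for k
    unfolding variation_def[of k "\<lambda>x. f x + g x"]
  proof (rule cSup_least)
    fix z assume "z \<in> {\<bar>(f x + g x) - (f y + g y)\<bar> | x y. \<forall>i<k. x i = y i}"
    then obtain x y where "z = \<bar>(f x + g x) - (f y + g y)\<bar>" "\<forall>i<k. x i = y i" by blast
    then show "z \<le> variation k f + variation k g"
      using variation_ge[OF assms(1-3), of k x y] variation_ge[OF assms(1,2,4), of k x y] by auto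
  qed auto
  then have "variation k (\<lambda>x. f x + g x) / A k \<le> variation k f / A k + variation k g / A k" for k
    using assms(1)[of k] by (simp add: divide_right_mono flip: add_divide_distrib)
  then have "variation k (\<lambda>x. f x + g x) / A k \<le> lip_const A f + lip_const A g" for k
    using lip_const_ge[OF assms(1-3), of k] lip_const_ge[OF assms(1,2,4), of k]
    by (meson add_mono order_trans)
  then have "lip_const A (\<lambda>x. f x + g x) \<le> lip_const A f + lip_const A g"
    unfolding lip_const_def[of A "\<lambda>x. f x + g x"] by (intro cSUP_least) auto
  moreover have "\<bar>f x + g x\<bar> \<le> sup_norm f + sup_norm g" for x
    using sup_norm_ge[OF assms(1-3), of x] sup_norm_ge[OF assms(1,2,4), of x] by linarith
  then have "sup_norm (\<lambda>x. f x + g x) \<le> sup_norm f + sup_norm g"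
    unfolding sup_norm_def[of "\<lambda>x. f x + g x"] by (intro cSUP_least) auto
  ultimately show ?thesis by (simp add: lip_norm_def)
qed

lemma lip_norm_minus_commute: "lip_norm A (\<lambda>x. f x - g x) = lip_norm A (\<lambda>x. g x - f x)"
proof -
  have "\<bar>(f x - g x) - (f y - g y)\<bar> = \<bar>(g x - f x) - (g y - f y)\<bar>" for x y by linarith
  then show ?thesis
    by (simp add: lip_norm_def lip_const_def variation_def sup_norm_def abs_minus_commute)
qed

lemma Metric_space_lip_space:
  assumes "\<And>n. A n > 0" "decseq A"
  shows "Metric_space (lip_space A :: ((nat \<Rightarrow> 'a) \<Rightarrow> real) set) (lip_dist A)"
proof
  fix f g h :: "(nat \<Rightarrow> 'a) \<Rightarrow> real"
  show "0 \<le> lip_dist A f g"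
  proof (cases "f \<in> lip_space A \<and> g \<in> lip_space A")
    case True
    then have fg: "(\<lambda>x. f x - g x) \<in> lip_space A" by (simp add: lip_space_diff)
    show ?thesis
      using lip_const_nonneg[OF assms fg] order_trans[OF abs_ge_zero sup_norm_ge[OF assms fg]]
      by (simp add: lip_dist_def lip_norm_def)
  qed (auto simp: lip_dist_def)
  show "lip_dist A f g = lip_dist A g f"
    by (simp add: lip_dist_def lip_norm_minus_commute[of A f g])
  show "lip_dist A f g = 0 \<longleftrightarrow> f = g" if "f \<in> lip_space A" "g \<in> lip_space A"
    using lip_norm_eq_0_iff[OF assms lip_space_diff[OF that]] that
    by (auto simp: fun_eq_iff lip_dist_def)
  show "lip_dist A f h \<le> lip_dist A f g + lip_dist A g h"
    if "f \<in> lip_space A" "g \<in> lip_space A" "h \<in> lip_space A"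
    using lip_norm_triangle[OF assms lip_space_diff[of f A g] lip_space_diff[of g A h]] that
    by (simp add: lip_dist_def)
qed

lemma space_seq_borel [simp]: "space seq_borel = UNIV"
  by (simp add: seq_borel_def)

lemma openin_sets_seq_borel:
  "openin (product_topology (\<lambda>_. discrete_topology UNIV) UNIV) U \<Longrightarrow> U \<in> sets seq_borel"
  by (simp add: seq_borel_def)

lemma measurable_full_shift: "full_shift \<in> measurable seq_borel seq_borel"
  unfolding seq_borel_def
proof (rule measurable_sigma_sets)
  fix U :: "(nat \<Rightarrow> 'a) set"
  let ?T = "product_topology (\<lambda>_. discrete_topology (UNIV :: 'a set)) (UNIV :: nat set)"
  assume "U \<in> {U. openin ?T U}"
  moreover have "continuous_map ?T ?T full_shift"
    unfolding continuous_map_componentwise_UNIV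
    using continuous_map_product_projection[of _ UNIV "\<lambda>_. discrete_topology (UNIV :: 'a set)"]
    by (auto simp: full_shift_def)
  ultimately show "full_shift -` U \<inter> space (sigma UNIV {U. openin ?T U}) \<in> sets (sigma UNIV {U. openin ?T U})"
    by (auto dest!: openin_continuous_map_preimage simp: vimage_def)
qed (auto simp: seq_borel_def)

lemma singleton_sets_seq_borel: "{x} \<in> sets seq_borel"
proof -
  let ?T = "product_topology (\<lambda>_. discrete_topology (UNIV :: 'a set)) (UNIV :: nat set)"
  have "closedin ?T {x}"
    by (rule closedin_Hausdorff_singleton) (auto simp: Hausdorff_space_product_topology)
  then have "UNIV - {x} \<in> sets seq_borel"
    by (intro openin_sets_seq_borel) (auto simp: closedin_def)
  from sets.compl_sets[OF this] show ?thesis by (simp add: Diff_Diff_Int)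
qed

lemma invariant_prob_orbit_ex1:
  fixes y :: "nat \<Rightarrow> 'a"
  assumes "periodic y"
  shows "\<exists>!\<mu>. invariant_prob \<mu> \<and> measure \<mu> (orbit y) = 1"
proof -
  obtain p where p: "p \<ge> 1" "(full_shift ^^ p) y = y" using assms by (auto simp: periodic_def)
  define g where "g i = (full_shift ^^ i) y" for i
  have gmod: "g (i mod p) = g i" for i
    unfolding g_def by (rule funpow_mod_eq[OF p(2)])
  have orb: "orbit y = g ` {..<p}"
  proof -
    have "g i \<in> g ` {..<p}" for i
      using gmod[of i] p(1) by (metis imageI lessThan_iff mod_less_divisor less_eq_Suc_le One_nat_def)
    then show ?thesis by (auto simp: orbit_def g_def)
  qed
  have fin: "finite (orbit y)" by (simp add: orb)
  have sg: "full_shift (g i) = g (Suc i)" for i by (simp add: g_def)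
  have fin_sets: "S \<in> sets seq_borel" if "S \<subseteq> orbit y" for S
    using finite_subset[OF that fin]
    by (induction S rule: finite_induct) (auto intro: sets.insert_in_sets singleton_sets_seq_borel)
  define q where "q = pmf_of_set {..<p}"
  have ne: "{..<p} \<noteq> {}" using p(1) by (auto simp: lessThan_empty_iff)
  define \<mu> where "\<mu> = distr (measure_pmf q) seq_borel g"
  have "map_pmf (\<lambda>i. Suc i mod p) q = q"
  proof -
    have inj: "inj_on (\<lambda>i. Suc i mod p) {..<p}"
      by (auto simp: inj_on_def mod_Suc split: if_splits)
    moreover have "(\<lambda>i. Suc i mod p) ` {..<p} = {..<p}"
      by (rule endo_inj_surj[OF _ _ inj]) (use p in auto)
    ultimately show ?thesis
      unfolding q_def by (subst map_pmf_of_set_inj) (use ne in auto)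
  qed
  then have "distr (measure_pmf (map_pmf (\<lambda>i. Suc i mod p) q)) seq_borel g = \<mu>"
    by (simp add: \<mu>_def)
  then have "distr (measure_pmf q) seq_borel (\<lambda>i. g (Suc i mod p)) = \<mu>"
    unfolding map_pmf_rep_eq by (subst (asm) distr_distr) (auto simp: comp_def)
  then have dist: "distr \<mu> seq_borel full_shift = \<mu>"
    unfolding \<mu>_def
    by (subst distr_distr) (auto simp: measurable_full_shift comp_def sg gmod)
  have "distr \<mu> \<mu> full_shift = \<mu>"
    using dist by (metis distr_cong sets_distr)
  moreover have "prob_space \<mu>"
    unfolding \<mu>_def by (intro measure_pmf.prob_space_distr) auto
  moreover have "measure \<mu> (orbit y) = 1"
  proof -
    have "measure \<mu> (orbit y) = measure (measure_pmf q) (g -` orbit y)"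
      unfolding \<mu>_def by (subst measure_distr) (auto simp: fin_sets)
    also have "g -` orbit y = UNIV" by (auto simp: orbit_def g_def)
    finally show ?thesis by simp
  qed
  ultimately have ex: "invariant_prob \<mu> \<and> measure \<mu> (orbit y) = 1"
    by (simp add: invariant_prob_def \<mu>_def)
  have formula: "measure \<nu> B = card (B \<inter> orbit y) / card (orbit y)"
    if \<nu>: "invariant_prob \<nu>" "measure \<nu> (orbit y) = 1" and B: "B \<in> sets seq_borel" for \<nu> B
  proof -
    interpret prob_space \<nu> using \<nu> by (simp add: invariant_prob_def)
    have sets: "sets \<nu> = sets seq_borel" and inv: "distr \<nu> \<nu> full_shift = \<nu>"
      using \<nu> by (auto simp: invariant_prob_def)
    have sp: "space \<nu> = UNIV" using sets_eq_imp_space_eq[OF sets] by simp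
    have ms: "full_shift \<in> measurable \<nu> \<nu>"
      using measurable_full_shift by (simp add: measurable_cong_sets[OF sets sets])
    have step: "measure \<nu> {g i} \<le> measure \<nu> {g (Suc i)}" for i
    proof -
      have "measure \<nu> {g (Suc i)} = measure (distr \<nu> \<nu> full_shift) {g (Suc i)}" by (simp add: inv)
      also have "\<dots> = measure \<nu> (full_shift -` {g (Suc i)})"
        by (subst measure_distr) (auto simp: ms sets sp singleton_sets_seq_borel)
      also have "measure \<nu> {g i} \<le> \<dots>"
        by (rule finite_measure_mono)
          (use measurable_sets[OF ms, of "{g (Suc i)}"] in \<open>auto simp: sg sets sp singleton_sets_seq_borel\<close>)
      finally show ?thesis by simp
    qed
    have mono: "measure \<nu> {g i} \<le> measure \<nu> {g j}" if "i \<le> j" for i j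
      using lift_Suc_mono_le[of "\<lambda>i. measure \<nu> {g i}", OF step that] .
    have le: "measure \<nu> {g i} \<le> measure \<nu> {g j}" for i j
    proof -
      have "i \<le> j + i * p" using p(1) by (cases p) auto
      then have "measure \<nu> {g i} \<le> measure \<nu> {g (j + i * p)}" by (rule mono)
      also have "g (j + i * p) = g j" using gmod[of "j + i * p"] gmod[of j] by simp
      finally show ?thesis .
    qed
    then have const: "measure \<nu> {z} = measure \<nu> {y}" if "z \<in> orbit y" for z
      using that orb by (metis (no_types, lifting) antisym funpow_0 g_def imageE)
    have cnt: "measure \<nu> S = card S * measure \<nu> {y}" if "S \<subseteq> orbit y" for S
    proof -
      have "measure \<nu> S = (\<Sum>z\<in>S. measure \<nu> {z})"
        by (rule finite_measure_eq_sum_singleton[OF finite_subset[OF that fin]])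
          (simp add: sets singleton_sets_seq_borel)
      also have "\<dots> = (\<Sum>z\<in>S. measure \<nu> {y})" by (rule sum.cong) (use that const in auto)
      finally show ?thesis by simp
    qed
    have one: "card (orbit y) * measure \<nu> {y} = 1" using cnt[of "orbit y"] \<nu>(2) by simp
    have "measure \<nu> B = measure \<nu> (B \<inter> orbit y)"
      using measure_eq_AE[of "B" "B \<inter> orbit y"] prob_eq_1[of "orbit y"] \<nu>(2) B sets fin_sets
      by (intro finite_measure_eq_AE) auto
    also have "\<dots> = card (B \<inter> orbit y) * measure \<nu> {y}" by (rule cnt) auto
    also have "measure \<nu> {y} = 1 / card (orbit y)"
      using one by (cases "card (orbit y) = 0") (simp_all add: eq_divide_imp mult.commute)
    finally show ?thesis by simp
  qed
  show ?thesis
  proof (intro ex1I[where a = \<mu>])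
    show "invariant_prob \<mu> \<and> measure \<mu> (orbit y) = 1" by (rule ex)
  next
    fix \<nu> assume \<nu>: "invariant_prob \<nu> \<and> measure \<nu> (orbit y) = 1"
    interpret N: prob_space \<nu> using \<nu> by (simp add: invariant_prob_def)
    interpret M: prob_space \<mu> using ex by (simp add: invariant_prob_def)
    show "\<nu> = \<mu>"
      by (rule measure_eqI)
        (use \<nu> ex formula in \<open>auto simp: invariant_prob_def N.emeasure_eq_measure M.emeasure_eq_measure\<close>)
  qed
qed

end

theory Submission
  imports Defs
begin

text \<open>After subtracting a constant and a coboundary, \<open>f\<close> becomes a nonpositive function \<open>F\<close> with
  variations \<open>O(A k)\<close> whose averages over periodic orbits have supremum 0. Among long orbit segments on
  which \<open>F\<close> is almost 0, take a return to the same word of length \<open>N\<close> in the shortest possible time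
  and close it up to a periodic orbit. Its points are pairwise separated within the first \<open>N\<close> symbols,
  while the sum of \<open>\<bar>F\<bar>\<close> over the orbit is \<open>O(A (Suc N))\<close>. For large \<open>N\<close> this is negligible against
  the penalty \<open>\<epsilon> * A N\<close> that the perturbation \<open>- \<epsilon> * set_dist (orbit y)\<close> charges for leaving the
  orbit, so the orbit is optimal for the perturbed function, with room to spare for a further small
  perturbation.\<close>

section \<open>Birkhoff sums over the shift\<close>

abbreviation agree :: "nat \<Rightarrow> (nat \<Rightarrow> 'a) \<Rightarrow> (nat \<Rightarrow> 'a) \<Rightarrow> bool" where
  "agree k x y \<equiv> \<forall>i<k. x i = y i"

definition birkhoff :: "nat \<Rightarrow> ((nat \<Rightarrow> 'a) \<Rightarrow> real) \<Rightarrow> (nat \<Rightarrow> 'a) \<Rightarrow> real" where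
  "birkhoff n f x = (\<Sum>i<n. f ((full_shift ^^ i) x))"

lemma funpow_full_shift: "(full_shift ^^ n) x = (\<lambda>i. x (n + i))"
  by (induction n) (auto simp: full_shift_def)

lemma birkhoff_0 [simp]: "birkhoff 0 f x = 0"
  and birkhoff_1 [simp]: "birkhoff (Suc 0) f x = f x"
  by (simp_all add: birkhoff_def)

lemma birkhoff_Suc: "birkhoff (Suc n) f x = birkhoff n f x + f ((full_shift ^^ n) x)"
  by (simp add: birkhoff_def)

lemma birkhoff_add: "birkhoff (m + n) f x = birkhoff m f x + birkhoff n f ((full_shift ^^ m) x)"
  by (induction n) (simp_all add: birkhoff_Suc funpow_full_shift add.assoc)

lemma birkhoff_periodic:
  assumes "(full_shift ^^ p) y = y"
  shows "birkhoff p f ((full_shift ^^ k) y) = birkhoff p f y"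
  using birkhoff_add[of p k f y] birkhoff_add[of k p f y] assms by (simp add: add.commute)

lemma birkhoff_mult_period:
  assumes "(full_shift ^^ p) y = y"
  shows "birkhoff (k * p) f y = real k * birkhoff p f y"
proof (induction k)
  case (Suc k)
  show ?case
    using birkhoff_add[of "k * p" p f y] birkhoff_periodic[OF assms, of f "k * p"] Suc
    by (simp add: algebra_simps)
qed simp

lemma birkhoff_plus: "birkhoff n (\<lambda>x. f x + g x) x = birkhoff n f x + birkhoff n g x"
  and birkhoff_minus: "birkhoff n (\<lambda>x. f x - g x) x = birkhoff n f x - birkhoff n g x"
  and birkhoff_const: "birkhoff n (\<lambda>_. c) x = real n * c"
  by (simp_all add: birkhoff_def sum.distrib sum_subtractf)

lemma birkhoff_coboundary:
  "birkhoff n (\<lambda>x. \<phi> x - \<phi> (full_shift x)) x = \<phi> x - \<phi> ((full_shift ^^ n) x)"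
  by (induction n) (simp_all add: birkhoff_Suc)

lemma birkhoff_le:
  assumes "\<And>x. f x \<le> c"
  shows "birkhoff n f x \<le> real n * c"
  unfolding birkhoff_def using sum_bounded_above[of "{..<n}" "\<lambda>i. f ((full_shift ^^ i) x)" c] assms
  by simp

text \<open>Closing up: the first \<open>p\<close> symbols of \<open>u\<close> are repeated forever.
  Reducing an index by \<open>p\<close> at a time, the hypothesis carries the agreement
  \<open>N\<close> symbols past one period. With \<open>N = 0\<close> every word can be closed
  up.\<close>

lemma periodic_extension:
  fixes u :: "nat \<Rightarrow> 'a"
  assumes "p \<ge> 1" and "\<forall>k<N. u k = u (k + p)"
  obtains y where "(full_shift ^^ p) y = y" "agree (N + p) y u"
proof
  let ?y = "\<lambda>k. u (k mod p)"
  show "(full_shift ^^ p) ?y = ?y"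
    by (simp add: funpow_full_shift)
  have "k < N + p \<Longrightarrow> u (k mod p) = u k" for k
  proof (induction k rule: less_induct)
    case (less k)
    show ?case
    proof (cases "k < p")
      case False
      then have "u ((k - p) mod p) = u (k - p)" using less assms(1) by auto
      also have "\<dots> = u k" using False less.prems assms(2)[rule_format, of "k - p"] by auto
      finally show ?thesis using False by (simp add: le_mod_geq)
    qed simp
  qed
  then show "agree (N + p) ?y u" by blast
qed

section \<open>Superexponential sequences\<close>

locale superexp =
  fixes A :: "nat \<Rightarrow> real"
  assumes pos: "\<And>n. A n > 0"
    and dec: "decseq A"
    and lim: "A \<longlonglongrightarrow> 0"
    and ratio: "(\<lambda>n. A (Suc n) / A n) \<longlonglongrightarrow> 0"
begin

text \<open>Each shift uses up one symbol of an agreement, so variations of order \<open>A\<close>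
  accumulate to such tails in Birkhoff sums.\<close>

definition tail :: "nat \<Rightarrow> real" where
  "tail k = (\<Sum>j. A (j + k))"

lemma eventually_ratio_le:
  assumes "\<epsilon> > 0"
  shows "\<forall>\<^sub>F n in sequentially. A (Suc n) \<le> \<epsilon> * A n"
  using order_tendstoD(2)[OF ratio assms]
  by eventually_elim (use pos in \<open>simp add: pos_divide_less_eq less_imp_le\<close>)

lemma summable_A: "summable A"
proof -
  obtain M where "\<And>n. n \<ge> M \<Longrightarrow> A (Suc n) \<le> 1/2 * A n"
    using eventually_ratio_le[of "1/2"] by (auto simp: eventually_sequentially)
  then show ?thesis
    by (intro summable_ratio_test[of "1/2" M]) (use pos in \<open>auto simp: abs_of_pos\<close>)
qed

lemma summable_shift: "summable (\<lambda>j. A (j + k))"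
  using summable_A by (simp add: summable_iff_shift)

lemma tail_mono: "tail (Suc k) \<le> tail k"
  unfolding tail_def
  by (intro suminf_le summable_shift decseqD[OF dec]) simp

lemma tail_nonneg: "0 \<le> tail k"
  unfolding tail_def by (intro suminf_nonneg summable_shift) (simp add: pos less_imp_le)

text \<open>Once consecutive ratios are at most 1/2, a geometric series with sum
  \<open>2 * A k\<close> dominates. Accumulated shadowing errors are thus of the order of their
  largest term.\<close>

lemma eventually_tail_le: "\<forall>\<^sub>F k in sequentially. tail k \<le> 2 * A k"
proof -
  obtain M where M: "\<And>n. n \<ge> M \<Longrightarrow> A (Suc n) \<le> 1/2 * A n"
    using eventually_ratio_le[of "1/2"] by (auto simp: eventually_sequentially)
  have "tail k \<le> 2 * A k" if "k \<ge> M" for k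
  proof -
    have le: "A (j + k) \<le> A k * (1/2) ^ j" for j
    proof (induction j)
      case (Suc j)
      then show ?case using M[of "j + k"] that by simp
    qed simp
    have "(\<lambda>j. A k * (1/2) ^ j) sums (A k * (1 / (1 - 1/2)))"
      by (intro sums_mult geometric_sums) simp
    then have s: "(\<lambda>j. A k * (1/2) ^ j) sums (2 * A k)" by (simp add: mult.commute)
    show ?thesis
      unfolding tail_def
      using suminf_le[OF le summable_shift sums_summable[OF s]] sums_unique[OF s] by simp
  qed
  then show ?thesis by (auto simp: eventually_sequentially)
qed

text \<open>Reverse the order of summation; since \<open>n - i\<close> is at least 1, the smallest
  index is \<open>Suc k\<close>.\<close>

lemma sum_le_tail: "(\<Sum>i<n. A (k + (n - i))) \<le> tail (Suc k)"
proof -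
  have "(\<Sum>i<n. A (k + (n - i))) = (\<Sum>i<n. A ((n - Suc i) + Suc k))"
    by (intro sum.cong refl arg_cong[where f = A]) auto
  also have "\<dots> = (\<Sum>j<n. A (j + Suc k))"
    by (rule sum.nat_diff_reindex)
  also have "\<dots> \<le> tail (Suc k)"
    unfolding tail_def by (intro sum_le_suminf summable_shift) (auto simp: pos less_imp_le)
  finally show ?thesis .
qed

text \<open>After \<open>i\<close> shifts the points still agree on \<open>m + (n - i)\<close>
  symbols, which is at least \<open>Suc m\<close> for every summand. For \<open>m = N\<close> this
  gain of one index makes shadowing cost O(A (Suc N)) instead of O(A N).\<close>

lemma birkhoff_agree:
  assumes "\<And>k x y. k \<ge> m \<Longrightarrow> agree k x y \<Longrightarrow> \<bar>f x - f y\<bar> \<le> B * A k"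
    and "agree (m + n) x y" and "B \<ge> 0"
  shows "\<bar>birkhoff n f x - birkhoff n f y\<bar> \<le> B * tail (Suc m)"
proof -
  have "\<bar>f ((full_shift ^^ i) x) - f ((full_shift ^^ i) y)\<bar> \<le> B * A (m + (n - i))" if "i < n" for i
    by (rule assms(1)) (use that assms(2) in \<open>auto simp: funpow_full_shift\<close>)
  then have "\<bar>birkhoff n f x - birkhoff n f y\<bar> \<le> (\<Sum>i<n. B * A (m + (n - i)))"
    unfolding birkhoff_def sum_subtractf[symmetric]
    by (intro order_trans[OF sum_abs] sum_mono) auto
  also have "\<dots> = B * (\<Sum>i<n. A (m + (n - i)))"
    by (simp add: sum_distrib_left)
  also have "\<dots> \<le> B * tail (Suc m)"
    by (intro mult_left_mono sum_le_tail assms(3))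
  finally show ?thesis .
qed

section \<open>A sub-action\<close>

text \<open>The value \<open>\<beta>\<close> is the supremum of the averages over periodic orbits, and \<open>\<phi> x\<close> is the
  supremum of the Birkhoff sums of \<open>f - \<beta>\<close> along all finite backward orbits of \<open>x\<close>; these sums are
  bounded because every orbit segment is shadowed by a periodic orbit.\<close>

lemma subaction_exists:
  fixes f :: "(nat \<Rightarrow> 'a) \<Rightarrow> real"
  assumes lip: "\<forall>k x y. agree k x y \<longrightarrow> \<bar>f x - f y\<bar> \<le> C * A k"
  shows "\<exists>\<beta> \<phi> K. (\<forall>x. \<bar>\<phi> x\<bar> \<le> K)
    \<and> (\<forall>x. f x - \<beta> + (\<phi> x - \<phi> (full_shift x)) \<le> 0)
    \<and> (\<forall>k x y. agree k x y \<longrightarrow> \<bar>\<phi> x - \<phi> y\<bar> \<le> C * tail (Suc k))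
    \<and> (\<forall>\<delta>>0. \<exists>q z. q \<ge> 1 \<and> (full_shift ^^ q) z = z \<and> birkhoff q f z > real q * (\<beta> - \<delta>))"
proof -
  have var: "\<bar>f x - f y\<bar> \<le> C * A k" if "agree k x y" for k x y using lip that by blast
  have "0 \<le> C * A 0" using var[of 0 undefined undefined] by auto
  then have C: "C \<ge> 0" using pos[of 0] by (simp add: zero_le_mult_iff)
  define D where "D = \<bar>f undefined\<bar> + C * A 0"
  have fD: "f x \<le> D" for x
    using var[of 0 x undefined] by (auto simp: D_def)
  define P where "P = {birkhoff q f z / real q | q z. q \<ge> 1 \<and> (full_shift ^^ q) z = z}"
  define \<beta> where "\<beta> = Sup P"
  have Pne: "P \<noteq> {}"
  proof -
    have "(full_shift ^^ 1) (\<lambda>_. undefined) = (\<lambda>_. undefined :: 'a)"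
      by (simp add: funpow_full_shift full_shift_def)
    then show ?thesis unfolding P_def by blast
  qed
  have "v \<le> D" if "v \<in> P" for v
    using that birkhoff_le[of f D, OF fD] by (auto simp: P_def divide_le_eq mult.commute)
  then have Pbdd: "bdd_above P" by (rule bdd_aboveI)
  have per_le: "birkhoff q f z \<le> real q * \<beta>" if "(full_shift ^^ q) z = z" for q z
  proof (cases "q = 0")
    case False
    then have "birkhoff q f z / real q \<le> \<beta>"
      unfolding \<beta>_def by (intro cSup_upper Pbdd) (use that in \<open>force simp: P_def\<close>)
    then show ?thesis using False by (simp add: divide_le_eq mult.commute)
  qed simp
  define h where "h x = f x - \<beta>" for x
  have hvar: "\<bar>h x - h y\<bar> \<le> C * A k" if "agree k x y" for k x y
    using var[OF that] by (simp add: h_def)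
  have hb: "birkhoff n h z = birkhoff n f z - real n * \<beta>" for n z
    unfolding h_def by (simp add: birkhoff_minus birkhoff_const)
  define K where "K = C * tail (Suc 0)"
  \<comment> \<open>The segment is closed up with overlap 0. The resulting periodic orbit has
    \<open>h\<close>-sum at most 0 by the choice of \<beta>, so only the shadowing error
    remains.\<close>
  have hK: "birkhoff n h z \<le> K" for n z
  proof (cases "n = 0")
    case True
    then show ?thesis using C tail_nonneg by (simp add: K_def)
  next
    case False
    then obtain w where w: "(full_shift ^^ n) w = w" "agree (0 + n) w z"
      using periodic_extension[of n 0 z] by auto
    have "\<bar>birkhoff n h w - birkhoff n h z\<bar> \<le> C * tail (Suc 0)"
      by (rule birkhoff_agree[OF _ w(2) C]) (rule hvar)
    then show ?thesis using per_le[OF w(1)] hb[of n w] by (simp add: K_def)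
  qed
  define Q where "Q x = {birkhoff n h z | n z. (full_shift ^^ n) z = x}" for x
  define \<phi> where "\<phi> x = Sup (Q x)" for x
  have Qbdd: "bdd_above (Q x)" for x
    by (rule bdd_aboveI[of _ K]) (auto simp: Q_def hK)
  \<comment> \<open>The backward orbit of length 0 contributes the empty sum, so \<phi> is
    nonnegative.\<close>
  have Q0: "0 \<in> Q x" for x
    unfolding Q_def by (rule CollectI, rule exI[of _ 0], rule exI[of _ x]) simp
  have \<phi>0: "0 \<le> \<phi> x" for x
    unfolding \<phi>_def by (rule cSup_upper[OF Q0 Qbdd])
  have \<phi>K: "\<phi> x \<le> K" for x
    unfolding \<phi>_def by (rule cSup_least) (use Q0[of x] in \<open>auto simp: Q_def hK\<close>)
  have \<phi>ge: "birkhoff n h z \<le> \<phi> x" if "(full_shift ^^ n) z = x" for n z x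
    unfolding \<phi>_def by (rule cSup_upper[OF _ Qbdd]) (use that in \<open>auto simp: Q_def\<close>)
  \<comment> \<open>A backward orbit of \<open>x\<close> prolonged by one step is a backward orbit
    of \<open>full_shift x\<close>, with \<open>h x\<close> added to its sum.\<close>
  have step: "\<phi> x \<le> \<phi> (full_shift x) - h x" for x
    unfolding \<phi>_def[of x]
  proof (rule cSup_least)
    fix v assume "v \<in> Q x"
    then obtain n z where v: "v = birkhoff n h z" "(full_shift ^^ n) z = x" by (auto simp: Q_def)
    have "birkhoff (Suc n) h z \<le> \<phi> (full_shift x)"
      by (rule \<phi>ge) (use v in simp)
    then show "v \<le> \<phi> (full_shift x) - h x" using v by (simp add: birkhoff_Suc)
  qed (use Q0 in blast)
  \<comment> \<open>A backward orbit of \<open>x\<close> is moved to one of \<open>x'\<close> by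
    keeping its \<open>n\<close> prepended symbols; the two starting points then agree on
    \<open>k + n\<close> symbols.\<close>
  have \<phi>var: "\<phi> x \<le> \<phi> x' + C * tail (Suc k)" if xx': "agree k x x'" for k x x'
    unfolding \<phi>_def[of x]
  proof (rule cSup_least)
    fix v assume "v \<in> Q x"
    then obtain n z where v: "v = birkhoff n h z" "(full_shift ^^ n) z = x" by (auto simp: Q_def)
    define z' where "z' i = (if i < n then z i else x' (i - n))" for i
    have z': "(full_shift ^^ n) z' = x'" by (auto simp: funpow_full_shift z'_def)
    have ag: "agree (k + n) z z'"
    proof (intro allI impI)
      fix i assume i: "i < k + n"
      show "z i = z' i"
      proof (cases "i < n")
        case False
        then have "z i = x (i - n)" using fun_cong[OF v(2), of "i - n"] by (simp add: funpow_full_shift)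
        then show ?thesis using False i xx' by (simp add: z'_def)
      qed (simp add: z'_def)
    qed
    have "\<bar>birkhoff n h z - birkhoff n h z'\<bar> \<le> C * tail (Suc k)"
      by (rule birkhoff_agree[OF _ ag C]) (rule hvar)
    then show "v \<le> \<phi> x' + C * tail (Suc k)" using \<phi>ge[OF z'] v by simp
  qed (use Q0 in blast)
  show ?thesis
  proof (rule exI[of _ \<beta>], rule exI[of _ \<phi>], rule exI[of _ K], intro conjI allI impI)
    show "\<bar>\<phi> x\<bar> \<le> K" for x using \<phi>0[of x] \<phi>K[of x] by simp
    show "f x - \<beta> + (\<phi> x - \<phi> (full_shift x)) \<le> 0" for x using step[of x] by (simp add: h_def)
    show "\<bar>\<phi> x - \<phi> y\<bar> \<le> C * tail (Suc k)" if "agree k x y" for k x y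
      using \<phi>var[of k x y] \<phi>var[of k y x] that by (auto simp: abs_le_iff)
    show "\<exists>q z. q \<ge> 1 \<and> (full_shift ^^ q) z = z \<and> birkhoff q f z > real q * (\<beta> - \<delta>)"
      if "\<delta> > 0" for \<delta>
    proof -
      have "\<beta> - \<delta> < Sup P" using that by (simp add: \<beta>_def)
      then obtain v where "v \<in> P" "\<beta> - \<delta> < v" using less_cSup_iff[OF Pne Pbdd] by blast
      then obtain q z where "q \<ge> 1" "(full_shift ^^ q) z = z" "\<beta> - \<delta> < birkhoff q f z / real q"
        by (auto simp: P_def)
      then show ?thesis
        by (intro exI[of _ q] exI[of _ z]) (simp add: less_divide_eq mult.commute)
    qed
  qed
qed

section \<open>Closest returns\<close>

text \<open>Averaging over windows: the sums over \<open>Suc K\<close> consecutive points, taken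
  from all starting points of a periodic orbit, count every point \<open>Suc K\<close> times. Some
  window therefore has a sum above \<open>- \<delta>\<close>, and as all terms are nonpositive, each
  of them exceeds this bound as well.\<close>

lemma long_good_segment:
  fixes F :: "(nat \<Rightarrow> 'a) \<Rightarrow> real"
  assumes neg: "\<And>x. F x \<le> 0"
    and per: "\<forall>\<delta>>0. \<exists>q z. q \<ge> 1 \<and> (full_shift ^^ q) z = z \<and> birkhoff q F z > - real q * \<delta>"
    and "\<delta> > 0"
  shows "\<exists>z. \<forall>i\<le>K. F ((full_shift ^^ i) z) \<ge> - \<delta>"
proof -
  \<comment> \<open>Dividing by \<open>Suc K\<close> compensates for each point lying in that many
    windows.\<close>
  obtain q z where q: "q \<ge> 1" "(full_shift ^^ q) z = z"
    "birkhoff q F z > - real q * (\<delta> / real (Suc K))"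
    using per[rule_format, of "\<delta> / real (Suc K)"] \<open>\<delta> > 0\<close> by auto
  have "(\<Sum>i<q. birkhoff (Suc K) F ((full_shift ^^ i) z))
      = (\<Sum>k<Suc K. birkhoff q F ((full_shift ^^ k) z))"
    unfolding birkhoff_def
    by (subst sum.swap) (simp add: funpow_full_shift add.assoc add.left_commute add.commute del: sum.lessThan_Suc)
  also have "\<dots> = real (Suc K) * birkhoff q F z"
    by (simp add: birkhoff_periodic[OF q(2)] del: sum.lessThan_Suc)
  also have "\<dots> > real (Suc K) * (- real q * (\<delta> / real (Suc K)))"
    using q(3) by (intro mult_strict_left_mono) auto
  also have "real (Suc K) * (- real q * (\<delta> / real (Suc K))) = (\<Sum>i<q. - \<delta>)"
    by (simp add: field_simps del: of_nat_Suc)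
  finally obtain i where i: "i < q" "birkhoff (Suc K) F ((full_shift ^^ i) z) > - \<delta>"
    by (meson lessThan_iff not_le sum_mono)
  have "F ((full_shift ^^ k) ((full_shift ^^ i) z)) \<ge> - \<delta>" if "k \<le> K" for k
  proof -
    have "birkhoff (Suc K) F ((full_shift ^^ i) z) \<le> F ((full_shift ^^ k) ((full_shift ^^ i) z))"
      unfolding birkhoff_def
      by (subst sum.remove[of _ k]) (use that neg in \<open>auto intro!: sum_nonpos simp del: sum.lessThan_Suc\<close>)
    then show ?thesis using i by linarith
  qed
  then show ?thesis by blast
qed

text \<open>Pigeonhole yields a return to a word of length \<open>N\<close> by time
  \<open>CARD('a) ^ N\<close>; the shortest return time \<open>p\<close> is used. Two distinct
  points of the closed orbit sharing \<open>N\<close> symbols would reveal a still shorter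
  return.\<close>

lemma closest_return:
  fixes z :: "nat \<Rightarrow> 'a::finite"
  obtains i p y where "p \<ge> 1" "i + p \<le> CARD('a) ^ N" "(full_shift ^^ p) y = y"
    "agree (N + p) y ((full_shift ^^ i) z)"
    "\<forall>a b. agree N ((full_shift ^^ a) y) ((full_shift ^^ b) y)
       \<longrightarrow> (full_shift ^^ a) y = (full_shift ^^ b) y"
proof -
  define T :: "nat \<Rightarrow> nat \<Rightarrow> 'a" where "T i = (full_shift ^^ i) z" for i
  define R where "R p \<longleftrightarrow> p \<ge> 1 \<and> (\<exists>i. i + p \<le> CARD('a) ^ N \<and> agree N (T i) (T (i + p)))" for p
  have "\<exists>p. R p"
  proof -
    let ?g = "\<lambda>i. map (T i) [0..<N]"
    have "card (?g ` {..CARD('a) ^ N}) \<le> card {xs :: 'a list. set xs \<subseteq> UNIV \<and> length xs = N}"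
      by (rule card_mono[OF finite_lists_length_eq]) auto
    also have "\<dots> = CARD('a) ^ N"
      by (rule card_lists_length_eq) simp
    finally have "\<not> inj_on ?g {..CARD('a) ^ N}"
      by (intro pigeonhole) simp
    then obtain i j where ij: "i \<le> CARD('a) ^ N" "j \<le> CARD('a) ^ N" "i \<noteq> j" "?g i = ?g j"
      by (auto simp: inj_on_def)
    have ex: "\<exists>p. R p" if "i < j" "j \<le> CARD('a) ^ N" "?g i = ?g j" for i j
    proof -
      have "R (j - i)" unfolding R_def
        by (intro conjI exI[of _ i]) (use that in auto)
      then show ?thesis by blast
    qed
    show ?thesis
    proof (cases "i < j")
      case True
      then show ?thesis using ex[of i j] ij by simp
    next
      case False
      then show ?thesis using ex[of j i] ij by simp
    qed
  qed
  define p where "p = (LEAST p. R p)"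
  have "R p" unfolding p_def by (rule LeastI_ex) fact
  then obtain i where p: "p \<ge> 1" and i: "i + p \<le> CARD('a) ^ N" "agree N (T i) (T (i + p))"
    by (auto simp: R_def)
  have min: "\<not> R p'" if "p' < p" for p' using that not_less_Least unfolding p_def by blast
  obtain y where y: "(full_shift ^^ p) y = y" "agree (N + p) y (T i)"
  proof (rule periodic_extension[OF p, of N "T i"])
    show "\<forall>k<N. T i k = T i (k + p)"
      using i(2) by (auto simp: T_def funpow_full_shift add_ac)
  qed
  \<comment> \<open>Since \<open>b < p\<close>, both words of length \<open>N\<close> lie within the
    first \<open>N + p\<close> symbols, where \<open>y\<close> copies the segment. They coincide
    there too, which is a return in time \<open>b - a < p\<close>.\<close>
  have sep: "False" if "a < b" "b < p" "agree N ((full_shift ^^ a) y) ((full_shift ^^ b) y)" for a b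
  proof -
    have "agree N (T (i + a)) (T (i + a + (b - a)))"
    proof (intro allI impI)
      fix k assume k: "k < N"
      have "T i (a + k) = y (a + k)" "T i (b + k) = y (b + k)" using y(2) that k by auto
      moreover have "y (a + k) = y (b + k)" using that(3) k by (simp add: funpow_full_shift)
      ultimately show "T (i + a) k = T (i + a + (b - a)) k"
        using that(1) by (simp add: T_def funpow_full_shift add.assoc)
    qed
    then have "R (b - a)"
      unfolding R_def using that i(1) by (intro conjI exI[of _ "i + a"]) auto
    then show False using min[of "b - a"] that by auto
  qed
  have "(full_shift ^^ a) y = (full_shift ^^ b) y"
    if "agree N ((full_shift ^^ a) y) ((full_shift ^^ b) y)" for a b
  proof -
    have red: "(full_shift ^^ (a mod p)) y = (full_shift ^^ a) y" for a
      by (rule funpow_mod_eq[OF y(1)])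
    have "a mod p = b mod p"
      using sep[of "a mod p" "b mod p"] sep[of "b mod p" "a mod p"] that p red[of a] red[of b]
      by (metis less_eq_Suc_le One_nat_def mod_less_divisor nat_neq_iff)
    then show ?thesis using red[of a] red[of b] by metis
  qed
  then show ?thesis using p i(1) y unfolding T_def by (intro that[of p i y]) blast+
qed

text \<open>At most \<open>CARD('a) ^ N\<close> points are used, so a loss of \<delta> at each adds
  up to at most \<open>A (Suc N)\<close>; closing up adds \<open>2 * B * A (Suc N)\<close>. The
  bound does not involve the period \<open>p\<close>.\<close>

lemma good_periodic_orbit:
  fixes F :: "(nat \<Rightarrow> 'a::finite) \<Rightarrow> real"
  assumes neg: "\<And>x. F x \<le> 0"
    and per: "\<forall>\<delta>>0. \<exists>q z. q \<ge> 1 \<and> (full_shift ^^ q) z = z \<and> birkhoff q F z > - real q * \<delta>"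
    and var: "\<forall>k\<ge>N. \<forall>x y. agree k x y \<longrightarrow> \<bar>F x - F y\<bar> \<le> B * A k"
    and B: "B \<ge> 0" and tail: "tail (Suc N) \<le> 2 * A (Suc N)"
  obtains p y where "p \<ge> 1" "(full_shift ^^ p) y = y"
    "- (2 * B + 1) * A (Suc N) \<le> birkhoff p F y"
    "\<forall>a b. agree N ((full_shift ^^ a) y) ((full_shift ^^ b) y)
       \<longrightarrow> (full_shift ^^ a) y = (full_shift ^^ b) y"
proof -
  define K where "K = CARD('a) ^ N"
  have K: "K > 0" by (simp add: K_def)
  define \<delta> where "\<delta> = A (Suc N) / real K"
  have \<delta>: "\<delta> > 0" using pos K by (simp add: \<delta>_def)
  obtain z where z: "\<forall>i\<le>K. F ((full_shift ^^ i) z) \<ge> - \<delta>"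
    using long_good_segment[of F \<delta> K, OF neg per \<delta>] by (rule exE)
  obtain i p y where p: "p \<ge> 1" "i + p \<le> CARD('a) ^ N" and y: "(full_shift ^^ p) y = y"
    "agree (N + p) y ((full_shift ^^ i) z)"
    and sep: "\<forall>a b. agree N ((full_shift ^^ a) y) ((full_shift ^^ b) y)
       \<longrightarrow> (full_shift ^^ a) y = (full_shift ^^ b) y"
    by (rule closest_return[of N z])
  have "\<bar>birkhoff p F y - birkhoff p F ((full_shift ^^ i) z)\<bar> \<le> B * tail (Suc N)"
    by (rule birkhoff_agree[OF _ y(2) B]) (use var in blast)
  also have "\<dots> \<le> B * (2 * A (Suc N))" by (rule mult_left_mono[OF tail B])
  finally have "birkhoff p F y \<ge> birkhoff p F ((full_shift ^^ i) z) - 2 * B * A (Suc N)" by simp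
  moreover have "birkhoff p F ((full_shift ^^ i) z) \<ge> (\<Sum>k<p. - \<delta>)"
    unfolding birkhoff_def
  proof (rule sum_mono)
    fix k assume "k \<in> {..<p}"
    then show "- \<delta> \<le> F ((full_shift ^^ k) ((full_shift ^^ i) z))"
      using z[rule_format, of "i + k"] p by (simp add: K_def funpow_full_shift add.assoc add.left_commute)
  qed
  moreover have "real p * \<delta> \<le> real K * \<delta>" using p(2) \<delta> by (intro mult_right_mono) (auto simp: K_def)
  moreover have "real K * \<delta> = A (Suc N)" using K by (simp add: \<delta>_def)
  ultimately have "- (2 * B + 1) * A (Suc N) \<le> birkhoff p F y" by (simp add: algebra_simps)
  then show ?thesis by (rule that[OF p(1) y(1) _ sep])
qed

section \<open>Boundedness of Birkhoff sums of the perturbed function\<close>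

text \<open>An orbit is cut into blocks that follow the periodic orbit and end at the moment of departure,
  where the penalty is at least \<open>\<epsilon> * A N\<close>. The Lipschitz estimate for \<open>F\<close> is used only before the
  departure, where it costs \<open>O(A (Suc N))\<close>; at the departure itself \<open>F \<le> 0\<close> suffices.\<close>

lemma perturbed_birkhoff_bounded:
  fixes F e d :: "(nat \<Rightarrow> 'a) \<Rightarrow> real"
  assumes neg: "\<And>x. F x \<le> 0"
    and var: "\<forall>k\<ge>N. \<forall>x y. agree k x y \<longrightarrow> \<bar>F x - F y\<bar> \<le> B * A k"
    and B: "B \<ge> 0" and tail: "tail (Suc N) \<le> 2 * A (Suc N)"
    and p: "p \<ge> 1" and y: "(full_shift ^^ p) y = y"
    and s: "- s \<le> birkhoff p F y" "0 \<le> s"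
    and sep: "\<And>a b. agree N ((full_shift ^^ a) y) ((full_shift ^^ b) y)
       \<Longrightarrow> (full_shift ^^ a) y = (full_shift ^^ b) y"
    and d0: "\<And>x. 0 \<le> d x" "\<And>x. x \<in> orbit y \<Longrightarrow> d x = 0"
    and dN: "\<And>x. (\<And>a. \<not> agree (Suc N) x ((full_shift ^^ a) y)) \<Longrightarrow> A N \<le> d x"
    and e: "\<And>x. \<bar>e x\<bar> \<le> \<eta>"
    and evar: "\<And>k x y. k \<ge> N \<Longrightarrow> agree k x y \<Longrightarrow> \<bar>e x - e y\<bar> \<le> \<eta> * A k"
    and \<epsilon>: "0 \<le> \<epsilon>"
    and c: "real p * c = birkhoff p (\<lambda>x. F x + e x) y"
    and small: "2 * (B + \<eta>) * A (Suc N) + 2 * s + (2 * real p + 2) * \<eta> \<le> \<epsilon> * A N"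
  shows "birkhoff n (\<lambda>x. F x - \<epsilon> * d x + e x - c) x
           \<le> 2 * (B + \<eta>) * A (Suc N) + s + 2 * real p * \<eta>"
proof -
  define G where "G x = F x - \<epsilon> * d x + e x - c" for x
  \<comment> \<open>Dropping the penalty gives a majorant of \<open>G\<close> whose variation
    involves only \<open>B + \<eta>\<close>, not \<epsilon>.\<close>
  define H where "H x = F x + e x - c" for x
  \<comment> \<open>Shadowing error plus the bound \<open>Horb\<close> for sums along the periodic
    orbit.\<close>
  define M where "M = 2 * (B + \<eta>) * A (Suc N) + s + 2 * real p * \<eta>"
  have \<eta>: "0 \<le> \<eta>" using order_trans[OF abs_ge_zero e[of undefined]] .
  have GH: "G x \<le> H x" for x using d0(1)[of x] \<epsilon> by (simp add: G_def H_def)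
  have "- (real p * \<eta>) \<le> birkhoff p e y"
    using birkhoff_le[of "\<lambda>x. - e x" \<eta> p y] e
    by (auto simp: birkhoff_def sum_negf abs_le_iff)
  then have pc: "- (real p * c) \<le> s + real p * \<eta>"
    using s c by (simp add: birkhoff_plus)
  have c_le: "- c \<le> s + \<eta>"
  proof -
    have "real p * (- c) \<le> real p * (s + \<eta>)"
      using pc p s(2) mult_right_mono[of 1 "real p" s] by (simp add: algebra_simps)
    then show ?thesis by (rule mult_left_le_imp_le) (use p in simp)
  qed
  have H_le: "H x \<le> \<eta> - c" for x using neg[of x] e[of x] by (simp add: H_def abs_le_iff)
  have Hp: "birkhoff p H y = 0"
    unfolding H_def using c by (simp add: birkhoff_minus birkhoff_const)
  \<comment> \<open>Full periods contribute 0 by the choice of \<open>c\<close>; the fewer than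
    \<open>p\<close> remaining terms are each at most \<open>\<eta> - c\<close>.\<close>
  have Horb: "birkhoff n H ((full_shift ^^ a) y) \<le> s + 2 * real p * \<eta>" for n a
  proof -
    let ?y = "(full_shift ^^ a) y"
    have y': "(full_shift ^^ p) ?y = ?y"
      using y by (metis (no_types, lifting) add.commute comp_apply funpow_add)
    have "birkhoff n H ?y = birkhoff (n mod p) H ((full_shift ^^ (n div p * p)) ?y)"
      using birkhoff_add[of "n div p * p" "n mod p" H ?y]
      by (simp add: birkhoff_mult_period[OF y'] birkhoff_periodic[OF y] Hp)
    also have "\<dots> \<le> real (n mod p) * (\<eta> - c)" by (rule birkhoff_le[OF H_le])
    also have "\<dots> \<le> s + 2 * real p * \<eta>"
    proof (cases "\<eta> - c \<ge> 0")
      case True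
      then have "real (n mod p) * (\<eta> - c) \<le> real p * (\<eta> - c)"
        using p by (intro mult_right_mono) (auto simp: less_imp_le)
      then show ?thesis using pc by (simp add: algebra_simps)
    next
      case False
      then have "real (n mod p) * (\<eta> - c) \<le> 0" by (simp add: mult_nonneg_nonpos)
      also have "0 \<le> s + 2 * real p * \<eta>" using s(2) \<eta> by simp
      finally show ?thesis .
    qed
    finally show ?thesis .
  qed
  have Hvar: "\<bar>H x - H y\<bar> \<le> (B + \<eta>) * A k" if "k \<ge> N" "agree k x y" for k x y
  proof -
    have "\<bar>F x - F y\<bar> \<le> B * A k" using var that by blast
    then show ?thesis using evar[OF that] by (simp add: H_def algebra_simps abs_le_iff)
  qed
  have follow: "birkhoff n G x \<le> M" if "agree (N + n) x ((full_shift ^^ a) y)" for n x a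
  proof -
    have "birkhoff n G x \<le> birkhoff n H x"
      unfolding birkhoff_def by (intro sum_mono GH)
    also have "\<dots> \<le> birkhoff n H ((full_shift ^^ a) y) + (B + \<eta>) * tail (Suc N)"
    proof -
      have "\<bar>birkhoff n H x - birkhoff n H ((full_shift ^^ a) y)\<bar> \<le> (B + \<eta>) * tail (Suc N)"
        by (rule birkhoff_agree[OF _ that]) (use Hvar B \<eta> in auto)
      then show ?thesis by linarith
    qed
    also have "\<dots> \<le> M"
      using Horb[of n a] mult_left_mono[OF tail, of "B + \<eta>"] B \<eta> by (simp add: M_def algebra_simps)
    finally show ?thesis .
  qed
  \<comment> \<open>Before the penalty, \<open>G x\<close> is at most \<open>s + 2 * \<eta>\<close>.
    The second \<open>s\<close> and the extra \<open>2 * \<eta>\<close> in \<open>small\<close>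
    absorb this and leave \<open>- M\<close>.\<close>
  have away: "G x \<le> - M" if "\<And>a. \<not> agree (Suc N) x ((full_shift ^^ a) y)" for x
  proof -
    have "\<epsilon> * A N \<le> \<epsilon> * d x" by (rule mult_left_mono[OF dN[OF that] \<epsilon>])
    then show ?thesis
      using neg[of x] e[of x] c_le small by (simp add: G_def M_def algebra_simps abs_le_iff)
  qed
  have M0: "0 \<le> M" using B \<eta> s(2) pos[of "Suc N"] by (simp add: M_def)
  \<comment> \<open>Each departure loses at least \<open>M\<close>, which pays for the block before
    it, so the bound does not accumulate over blocks.\<close>
  have "birkhoff n G x \<le> M"
  proof (induction n arbitrary: x rule: less_induct)
    case (less n)
    consider "n = 0" | "n > 0" "\<And>a. \<not> agree (Suc N) x ((full_shift ^^ a) y)"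
      | a where "agree (N + n) x ((full_shift ^^ a) y)"
      | a where "n > 0" "agree (Suc N) x ((full_shift ^^ a) y)" "\<not> agree (N + n) x ((full_shift ^^ a) y)"
      by blast
    then show ?case
    proof cases
      case 1
      then show ?thesis using M0 by simp
    next
      case 2
      then have "birkhoff n G x = G x + birkhoff (n - 1) G ((full_shift ^^ 1) x)"
        using birkhoff_add[of 1 "n - 1" G x] by simp
      then show ?thesis using away[OF 2(2)] less.IH[of "n - 1" "(full_shift ^^ 1) x"] 2(1) M0 by simp
    next
      case 3
      then show ?thesis by (rule follow)
    next
      case 4
      let ?w = "(full_shift ^^ a) y"
      define m where "m = (LEAST i. x i \<noteq> ?w i)"
      have ex: "\<exists>i<N + n. x i \<noteq> ?w i" using 4(3) by blast
      then have m: "x m \<noteq> ?w m" unfolding m_def by (metis (mono_tags, lifting) LeastI)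
      have agm: "agree m x ?w" unfolding m_def using not_less_Least by blast
      have mn: "m < N + n" using ex agm by (metis linorder_neqE_nat order.strict_trans)
      have mN: "m > N" using 4(2) m by (metis not_less_eq)
      \<comment> \<open>The time at which exactly \<open>N\<close> symbols of the agreement are
        left.\<close>
      define l where "l = m - N"
      let ?x = "(full_shift ^^ l) x"
      have l: "m = N + l" "l < n" using mn mN by (auto simp: l_def)
      \<comment> \<open>By separation, \<open>(full_shift ^^ (a + l)) y\<close> is the only orbit
        point agreeing with \<open>?x\<close> on \<open>N\<close> symbols, and it differs from
        \<open>?x\<close> at place \<open>N\<close>.\<close>
      have "\<not> agree (Suc N) ?x ((full_shift ^^ b) y)" for b
      proof
        assume ag: "agree (Suc N) ?x ((full_shift ^^ b) y)"
        have "agree N ?x ((full_shift ^^ (a + l)) y)"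
          using agm l by (simp add: funpow_full_shift add_ac)
        then have "agree N ((full_shift ^^ b) y) ((full_shift ^^ (a + l)) y)"
          using ag by (metis less_Suc_eq)
        then have "(full_shift ^^ b) y = (full_shift ^^ (a + l)) y" by (rule sep)
        then have "?x N = (full_shift ^^ (a + l)) y N" using ag by auto
        then show False using m l by (simp add: funpow_full_shift add_ac)
      qed
      then have "G ?x \<le> - M" by (rule away)
      moreover have "birkhoff l G x \<le> M" using agm l by (intro follow[of _ _ a]) simp
      moreover have "birkhoff (n - Suc l) G ((full_shift ^^ Suc l) x) \<le> M"
        by (rule less.IH) (use l in auto)
      moreover have "birkhoff n G x = birkhoff l G x + G ?x + birkhoff (n - Suc l) G ((full_shift ^^ Suc l) x)"
        using birkhoff_add[of "Suc l" "n - Suc l" G x] l(2) by (simp add: birkhoff_Suc)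
      ultimately show ?thesis by linarith
    qed
  qed
  then show ?thesis unfolding G_def[abs_def] M_def .
qed

section \<open>Lipschitz functions and the distance from a set\<close>

lemma agree_Least: "agree (LEAST n. x n \<noteq> y n) x y"
  using not_less_Least by blast

lemma lip_spaceI:
  assumes "\<And>k x y. agree k x y \<Longrightarrow> \<bar>f x - f y\<bar> \<le> C * A k"
  shows "f \<in> lip_space A"
proof -
  have "\<bar>f x - f y\<bar> \<le> C * seq_dist A x y" for x y
    using assms[OF agree_Least[of x y]] by (auto simp: seq_dist_def)
  then show ?thesis by (auto simp: lip_space_def)
qed

lemma lip_norm_le:
  fixes f :: "(nat \<Rightarrow> 'a) \<Rightarrow> real"
  assumes "\<And>k x y. agree k x y \<Longrightarrow> \<bar>f x - f y\<bar> \<le> C * A k" and "\<And>x. \<bar>f x\<bar> \<le> D"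
  shows "lip_norm A f \<le> C + D"
proof -
  have "variation k f \<le> C * A k" for k
    unfolding variation_def by (rule cSup_least) (use assms(1) in auto)
  then have "variation k f / A k \<le> C" for k
    using pos[of k] by (simp add: pos_divide_le_eq)
  then have "lip_const A f \<le> C" unfolding lip_const_def by (intro cSUP_least) auto
  moreover have "sup_norm f \<le> D" unfolding sup_norm_def using assms(2) by (intro cSUP_least) auto
  ultimately show ?thesis by (simp add: lip_norm_def)
qed

lemma lip_norm_bounds:
  fixes f :: "(nat \<Rightarrow> 'a) \<Rightarrow> real"
  assumes f: "f \<in> lip_space A"
  shows "\<bar>f x\<bar> \<le> lip_norm A f" "agree k x y \<Longrightarrow> \<bar>f x - f y\<bar> \<le> lip_norm A f * A k"
proof -
  note lip = lip_const_nonneg[OF pos dec f] lip_const_ge[OF pos dec f, of k]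
  have sup: "\<bar>f x\<bar> \<le> sup_norm f" for x by (rule sup_norm_ge[OF pos dec f])
  show "\<bar>f x\<bar> \<le> lip_norm A f" using lip(1) sup[of x] by (simp add: lip_norm_def)
  assume "agree k x y"
  then have "\<bar>f x - f y\<bar> \<le> variation k f" by (rule variation_ge[OF pos dec f])
  also have "\<dots> \<le> lip_const A f * A k" using lip(2) pos[of k] by (simp add: pos_divide_le_eq)
  also have "\<dots> \<le> lip_norm A f * A k"
    using sup[of x] pos[of k] by (intro mult_right_mono) (auto simp: lip_norm_def)
  finally show "\<bar>f x - f y\<bar> \<le> lip_norm A f * A k" .
qed

definition set_dist :: "(nat \<Rightarrow> 'a) set \<Rightarrow> (nat \<Rightarrow> 'a) \<Rightarrow> real" where
  "set_dist S x = (INF z\<in>S. seq_dist A x z)"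

lemma seq_dist_nonneg: "0 \<le> seq_dist A x z"
  using seq_dist_le(1)[of A 0 x z] pos dec by simp

lemma seq_dist_self [simp]: "seq_dist A x x = 0"
  by (simp add: seq_dist_def)

lemma seq_dist_eq_0_iff: "seq_dist A x z = 0 \<longleftrightarrow> x = z"
  using pos by (auto simp: seq_dist_def less_le)

lemma set_dist_le: "z \<in> S \<Longrightarrow> set_dist S x \<le> seq_dist A x z"
  unfolding set_dist_def by (intro cINF_lower bdd_belowI[of _ 0]) (auto simp: seq_dist_nonneg)

lemma le_set_dist: "S \<noteq> {} \<Longrightarrow> (\<And>z. z \<in> S \<Longrightarrow> c \<le> seq_dist A x z) \<Longrightarrow> c \<le> set_dist S x"
  unfolding set_dist_def by (intro cINF_greatest)

lemma set_dist_nonneg: "S \<noteq> {} \<Longrightarrow> 0 \<le> set_dist S x"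
  by (rule le_set_dist) (auto simp: seq_dist_nonneg)

lemma set_dist_eq_0: "z \<in> S \<Longrightarrow> set_dist S z = 0"
  using set_dist_le[of z S z] set_dist_nonneg[of S z] by force

lemma set_dist_eq_0D:
  assumes "finite S" "S \<noteq> {}" "set_dist S x = 0"
  shows "x \<in> S"
proof -
  have "set_dist S x \<in> seq_dist A x ` S"
    unfolding set_dist_def using assms by (subst cInf_eq_Min) auto
  then show ?thesis using assms(3) seq_dist_eq_0_iff by force
qed

text \<open>Ultrametric argument: either \<open>x'\<close> and \<open>z\<close> agree on
  \<open>k\<close> symbols, and then so do \<open>x\<close> and \<open>z\<close>, or
  \<open>x\<close> and \<open>x'\<close> first differ from \<open>z\<close> at the same
  place.\<close>

lemma seq_dist_agree:
  assumes "agree k x x'"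
  shows "seq_dist A x z \<le> seq_dist A x' z + A k"
proof (cases "agree k x' z")
  case True
  then have "agree k x z" using assms by auto
  then have "seq_dist A x z \<le> A k" by (rule seq_dist_le(2)[OF pos dec])
  then show ?thesis using seq_dist_nonneg[of x' z] by linarith
next
  case False
  define j where "j = (LEAST i. x' i \<noteq> z i)"
  obtain i where i: "i < k" "x' i \<noteq> z i" using False by blast
  have j: "x' j \<noteq> z j" "j < k"
    using LeastI[of "\<lambda>i. x' i \<noteq> z i" i] Least_le[of "\<lambda>i. x' i \<noteq> z i" i] i
    unfolding j_def by auto
  have ag: "agree j x' z" unfolding j_def by (rule agree_Least)
  have "(LEAST i. x i \<noteq> z i) = j"
  proof (rule Least_equality)
    show "x j \<noteq> z j" using j assms by simp
    show "j \<le> i" if "x i \<noteq> z i" for i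
    proof (rule ccontr)
      assume "\<not> j \<le> i"
      then show False using that ag assms j(2) by simp
    qed
  qed
  moreover have "x \<noteq> z" "x' \<noteq> z" using j assms by auto
  ultimately have "seq_dist A x z = seq_dist A x' z"
    unfolding seq_dist_def j_def by simp
  then show ?thesis using pos[of k] by simp
qed

lemma set_dist_agree:
  assumes "S \<noteq> {}" "agree k x x'"
  shows "\<bar>set_dist S x - set_dist S x'\<bar> \<le> A k"
proof -
  have le: "set_dist S x - A k \<le> set_dist S x'" if "agree k x x'" for x x'
  proof (rule le_set_dist[OF assms(1)])
    fix z assume "z \<in> S"
    then show "set_dist S x - A k \<le> seq_dist A x' z"
      using set_dist_le[of z S x] seq_dist_agree[OF that, of z] by linarith
  qed
  show ?thesis using le[OF assms(2)] le[of x' x] assms(2) by (simp add: abs_le_iff)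
qed

lemma set_dist_bounded:
  assumes "S \<noteq> {}"
  shows "set_dist S x \<le> A 0"
proof -
  obtain z where "z \<in> S" using assms by blast
  then show ?thesis
    using set_dist_le[of z S x] seq_dist_le(2)[of A 0 x z] pos dec by simp
qed

text \<open>This is the penalty for leaving an orbit: the first difference occurs at place
  \<open>N\<close> or earlier, and \<open>A\<close> decreases.\<close>

lemma set_dist_away:
  assumes "S \<noteq> {}" "\<And>z. z \<in> S \<Longrightarrow> \<not> agree (Suc N) x z"
  shows "A N \<le> set_dist S x"
proof (rule le_set_dist[OF assms(1)])
  fix z assume "z \<in> S"
  then obtain i where i: "i \<le> N" "x i \<noteq> z i" using assms(2) by (metis less_Suc_eq_le)
  then have "(LEAST i. x i \<noteq> z i) \<le> N" using Least_le[of "\<lambda>i. x i \<noteq> z i" i] by linarith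
  then show "A N \<le> seq_dist A x z" using i decseqD[OF dec] by (auto simp: seq_dist_def)
qed

section \<open>Integrals against invariant measures\<close>

text \<open>Preimages of open sets are open in the product topology: \<open>C * A k\<close> tends to
  0, so \<open>f\<close> varies little on the cylinder fixing the first \<open>k\<close> symbols of
  \<open>x\<close>.\<close>

lemma lip_space_measurable:
  fixes f :: "(nat \<Rightarrow> 'a) \<Rightarrow> real"
  assumes "f \<in> lip_space A"
  shows "f \<in> borel_measurable seq_borel"
proof (rule borel_measurableI)
  fix S :: "real set" assume S: "open S"
  let ?T = "product_topology (\<lambda>_. discrete_topology (UNIV :: 'a set)) (UNIV :: nat set)"
  obtain C where C: "\<And>k x y. agree k x y \<Longrightarrow> \<bar>f x - f y\<bar> \<le> C * A k"
    using lip_spaceE[OF pos dec assms] by metis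
  have "openin ?T (f -` S)"
    unfolding openin_subopen[of _ "f -` S"]
  proof
    fix x assume "x \<in> f -` S"
    then obtain e where e: "e > 0" "\<And>r. dist r (f x) < e \<Longrightarrow> r \<in> S"
      using S by (auto simp: open_dist)
    have "(\<lambda>k. C * A k) \<longlonglongrightarrow> C * 0" by (intro tendsto_intros lim)
    then obtain k where k: "C * A k < e"
      using order_tendstoD(2)[of _ "C * 0" _ e] e(1) by (force simp: eventually_sequentially)
    let ?U = "PiE UNIV (\<lambda>i. if i < k then {x i} else UNIV)"
    have "{i \<in> UNIV. (if i < k then {x i} else UNIV) \<noteq> topspace (discrete_topology (UNIV :: 'a set))} \<subseteq> {..<k}"
      by auto
    then have "openin ?T ?U"
      unfolding openin_PiE_gen using finite_subset by fastforce
    moreover have "x \<in> ?U" by auto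
    moreover have "?U \<subseteq> f -` S"
    proof
      fix z assume "z \<in> ?U"
      then have "z i \<in> (if i < k then {x i} else UNIV)" for i by (rule PiE_mem) simp
      then have "agree k z x" by (metis singletonD)
      then have "dist (f z) (f x) < e" using C[of k z x] k by (simp add: dist_real_def)
      then show "z \<in> f -` S" using e(2) by simp
    qed
    ultimately show "\<exists>U. openin ?T U \<and> x \<in> U \<and> U \<subseteq> f -` S" by blast
  qed
  then show "f -` S \<inter> space seq_borel \<in> sets seq_borel"
    by (simp add: openin_sets_seq_borel)
qed

end

lemma invariant_probD:
  fixes \<nu> :: "(nat \<Rightarrow> 'a) measure"
  assumes "invariant_prob \<nu>"
  shows "prob_space \<nu>" "sets \<nu> = sets seq_borel" "full_shift \<in> measurable \<nu> \<nu>"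
    "distr \<nu> \<nu> full_shift = \<nu>"
proof -
  show sets: "sets \<nu> = sets seq_borel" and "prob_space \<nu>" "distr \<nu> \<nu> full_shift = \<nu>"
    using assms by (simp_all add: invariant_prob_def)
  show "full_shift \<in> measurable \<nu> \<nu>"
    using measurable_full_shift by (simp add: measurable_cong_sets[OF sets sets])
qed

lemma invariant_integral_birkhoff:
  assumes inv: "invariant_prob \<nu>" and h: "h \<in> borel_measurable \<nu>" and bdd: "\<And>x. \<bar>h x\<bar> \<le> D"
  shows "integrable \<nu> (birkhoff n h)" "integral\<^sup>L \<nu> (birkhoff n h) = real n * integral\<^sup>L \<nu> h"
proof -
  note T = invariant_probD[OF inv]
  interpret prob_space \<nu> by (rule T(1))
  have Ti: "(full_shift ^^ i) \<in> measurable \<nu> \<nu>" for i by (rule measurable_compose_n[OF T(3)])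
  have hi: "(\<lambda>x. h ((full_shift ^^ i) x)) \<in> borel_measurable \<nu>" for i
    by (rule measurable_compose[OF Ti h])
  have int: "integrable \<nu> (\<lambda>x. h ((full_shift ^^ i) x))" for i
    by (rule integrable_const_bound[of _ D, OF _ hi]) (simp add: bdd)
  have eq: "(\<integral>x. h ((full_shift ^^ i) x) \<partial>\<nu>) = integral\<^sup>L \<nu> h" for i
  proof (induction i)
    case (Suc i)
    have "(\<integral>x. h ((full_shift ^^ i) x) \<partial>distr \<nu> \<nu> full_shift)
        = (\<integral>x. h ((full_shift ^^ i) (full_shift x)) \<partial>\<nu>)"
      by (rule integral_distr[OF T(3) hi])
    then show ?case using Suc by (simp add: T(4) funpow_swap1)
  qed simp
  show "integrable \<nu> (birkhoff n h)"
    unfolding birkhoff_def by (intro Bochner_Integration.integrable_sum int)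
  show "integral\<^sup>L \<nu> (birkhoff n h) = real n * integral\<^sup>L \<nu> h"
    unfolding birkhoff_def by (subst Bochner_Integration.integral_sum[OF int]) (simp add: eq)
qed

text \<open>By invariance, integration bounds \<open>n\<close> times the integral of
  \<open>h\<close> by \<open>n * c + M\<close>; for large \<open>n\<close> the constant
  \<open>M\<close> cannot make up for an excess over \<open>c\<close>.\<close>

lemma invariant_integral_le:
  assumes inv: "invariant_prob \<nu>" and h: "h \<in> borel_measurable \<nu>" and bdd: "\<And>x. \<bar>h x\<bar> \<le> D"
    and le: "\<And>n x. birkhoff n h x \<le> real n * c + M"
  shows "integral\<^sup>L \<nu> h \<le> c"
proof (rule ccontr)
  interpret prob_space \<nu> by (rule invariant_probD(1)[OF inv])
  assume "\<not> integral\<^sup>L \<nu> h \<le> c"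
  then obtain n where "M < real n * (integral\<^sup>L \<nu> h - c)"
    using reals_Archimedean3[of "integral\<^sup>L \<nu> h - c"] by auto
  moreover have "integral\<^sup>L \<nu> (birkhoff n h) \<le> real n * c + M"
    by (rule integral_le_const[OF invariant_integral_birkhoff(1)[OF inv h bdd]]) (simp add: le)
  ultimately show False
    using invariant_integral_birkhoff(2)[OF inv h bdd, of n] by (simp add: algebra_simps)
qed

lemma orbit_measure:
  assumes "periodic y"
  shows "invariant_prob (orbit_measure y)" "measure (orbit_measure y) (orbit y) = 1"
    and "invariant_prob \<nu> \<Longrightarrow> measure \<nu> (orbit y) = 1 \<Longrightarrow> \<nu> = orbit_measure y"
proof -
  note ex1 = invariant_prob_orbit_ex1[OF assms]
  show "invariant_prob (orbit_measure y)" "measure (orbit_measure y) (orbit y) = 1"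
    using theI'[OF ex1] unfolding orbit_measure_def by simp_all
  show "\<nu> = orbit_measure y" if "invariant_prob \<nu>" "measure \<nu> (orbit y) = 1"
    using the1_equality[OF ex1, of \<nu>] that unfolding orbit_measure_def by simp
qed

lemma finite_orbit:
  assumes "p \<ge> 1" "(full_shift ^^ p) y = y"
  shows "finite (orbit y)"
proof -
  have "(full_shift ^^ i) y \<in> (\<lambda>i. (full_shift ^^ i) y) ` {..<p}" for i
    using funpow_mod_eq[OF assms(2), of i] assms(1)
    by (intro image_eqI[of _ _ "i mod p"]) auto
  then have "orbit y \<subseteq> (\<lambda>i. (full_shift ^^ i) y) ` {..<p}" by (auto simp: orbit_def)
  then show ?thesis by (rule finite_subset) simp
qed

text \<open>\<open>birkhoff p h\<close> is constant on the orbit, which carries full measure, and by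
  invariance its integral is \<open>p\<close> times that of \<open>h\<close>.\<close>

lemma orbit_measure_integral:
  fixes y :: "nat \<Rightarrow> 'a"
  assumes p: "p \<ge> 1" "(full_shift ^^ p) y = y"
    and h: "h \<in> borel_measurable seq_borel" and bdd: "\<And>x. \<bar>h x\<bar> \<le> D"
  shows "real p * integral\<^sup>L (orbit_measure y) h = birkhoff p h y"
proof -
  have y: "periodic y" using p by (auto simp: periodic_def)
  let ?\<mu> = "orbit_measure y"
  note inv = orbit_measure(1)[OF y]
  interpret prob_space ?\<mu> by (rule invariant_probD(1)[OF inv])
  have h': "h \<in> borel_measurable ?\<mu>"
    using h by (simp add: measurable_cong_sets[OF invariant_probD(2)[OF inv] refl])
  have "AE x in ?\<mu>. x \<in> orbit y" by (rule AE_prob_1[OF orbit_measure(2)[OF y]])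
  then have "AE x in ?\<mu>. birkhoff p h x = birkhoff p h y"
    by eventually_elim (auto simp: orbit_def birkhoff_periodic[OF p(2)])
  then have "integral\<^sup>L ?\<mu> (birkhoff p h) = (\<integral>x. birkhoff p h y \<partial>?\<mu>)"
    by (intro integral_cong_AE borel_measurable_integrable
        invariant_integral_birkhoff(1)[OF inv h' bdd]) auto
  then show ?thesis
    using invariant_integral_birkhoff(2)[OF inv h' bdd, of p] by (simp add: prob_space)
qed

section \<open>Locking by a distance perturbation\<close>

context superexp
begin

text \<open>The surplus \<open>\<epsilon> * set_dist (orbit y) x\<close> survives integration: the
  integral of \<open>g\<close> stays below \<open>c\<close> by at least \<epsilon> times the mean
  distance to the orbit. Equality makes this distance vanish almost everywhere, so the measure is
  carried by the orbit.\<close>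

lemma uniquely_optimizedI:
  fixes y :: "nat \<Rightarrow> 'a"
  assumes p: "p \<ge> 1" "(full_shift ^^ p) y = y" and g: "g \<in> lip_space A" and \<epsilon>: "\<epsilon> > 0"
    and le: "\<And>n x. birkhoff n (\<lambda>x. g x + \<epsilon> * set_dist (orbit y) x) x \<le> real n * c + M"
    and c: "birkhoff p g y = real p * c"
  shows "g \<in> uniquely_optimized A y"
proof -
  have y: "periodic y" using p by (auto simp: periodic_def)
  let ?d = "set_dist (orbit y)"
  have ne: "orbit y \<noteq> {}" by (simp add: orbit_def)
  have dm: "?d \<in> lip_space A"
    by (rule lip_spaceI[of _ 1]) (simp add: set_dist_agree[OF ne])
  note g_bdd = lip_norm_bounds(1)[OF g]
  have d_bdd: "\<bar>?d x\<bar> \<le> A 0" for x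
    using set_dist_nonneg[OF ne, of x] set_dist_bounded[OF ne, of x] by simp
  have key: "integral\<^sup>L \<nu> g + \<epsilon> * integral\<^sup>L \<nu> ?d \<le> c" "0 \<le> integral\<^sup>L \<nu> ?d" "integrable \<nu> ?d"
    if inv: "invariant_prob \<nu>" for \<nu>
  proof -
    interpret prob_space \<nu> by (rule invariant_probD(1)[OF inv])
    have gm: "g \<in> borel_measurable \<nu>" and dm': "?d \<in> borel_measurable \<nu>"
      using lip_space_measurable[OF g] lip_space_measurable[OF dm]
      by (simp_all add: measurable_cong_sets[OF invariant_probD(2)[OF inv] refl])
    have gi: "integrable \<nu> g"
      by (rule integrable_const_bound[of _ "lip_norm A g", OF _ gm]) (simp add: g_bdd)
    show di: "integrable \<nu> ?d"
      by (rule integrable_const_bound[of _ "A 0", OF _ dm']) (simp add: d_bdd)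
    have "\<bar>g x + \<epsilon> * ?d x\<bar> \<le> lip_norm A g + \<epsilon> * A 0" for x
    proof -
      have "\<bar>g x + \<epsilon> * ?d x\<bar> \<le> \<bar>g x\<bar> + \<epsilon> * \<bar>?d x\<bar>"
        using abs_triangle_ineq[of "g x" "\<epsilon> * ?d x"] \<epsilon> by (simp add: abs_mult)
      then show ?thesis using g_bdd[of x] mult_left_mono[OF d_bdd[of x], of \<epsilon>] \<epsilon> by linarith
    qed
    then have "integral\<^sup>L \<nu> (\<lambda>x. g x + \<epsilon> * ?d x) \<le> c"
      by (rule invariant_integral_le[OF inv _ _ le, rotated])
        (intro borel_measurable_add borel_measurable_times borel_measurable_const gm dm')
    then show "integral\<^sup>L \<nu> g + \<epsilon> * integral\<^sup>L \<nu> ?d \<le> c" using gi di by simp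
    show "0 \<le> integral\<^sup>L \<nu> ?d" by (simp add: set_dist_nonneg[OF ne])
  qed
  have \<mu>: "integral\<^sup>L (orbit_measure y) g = c"
    using orbit_measure_integral[OF p lip_space_measurable[OF g] g_bdd] c p(1) by simp
  have max: "maximizing g (orbit_measure y)"
    unfolding maximizing_def
  proof (intro conjI allI impI)
    show "invariant_prob (orbit_measure y)" by (rule orbit_measure(1)[OF y])
    fix \<nu> :: "(nat \<Rightarrow> 'a) measure" assume "invariant_prob \<nu>"
    note key[OF this]
    moreover have "0 \<le> \<epsilon> * integral\<^sup>L \<nu> ?d" using calculation \<epsilon> by simp
    ultimately show "integral\<^sup>L \<nu> g \<le> integral\<^sup>L (orbit_measure y) g" using \<mu> by linarith
  qed
  have "\<nu> = orbit_measure y" if "maximizing g \<nu>" for \<nu>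
  proof (rule orbit_measure(3)[OF y])
    show inv: "invariant_prob \<nu>" using that by (simp add: maximizing_def)
    interpret prob_space \<nu> by (rule invariant_probD(1)[OF inv])
    note k = key[OF inv]
    have "c \<le> integral\<^sup>L \<nu> g"
      using that orbit_measure(1)[OF y] unfolding maximizing_def \<mu>[symmetric] by blast
    then have "\<epsilon> * integral\<^sup>L \<nu> ?d \<le> 0" using k(1) by linarith
    then have "integral\<^sup>L \<nu> ?d = 0" using \<epsilon> k(2) by (simp add: mult_le_0_iff)
    then have "AE x in \<nu>. ?d x = 0"
      using integral_nonneg_eq_0_iff_AE[OF k(3)] set_dist_nonneg[OF ne] by simp
    then have ae: "AE x in \<nu>. x \<in> orbit y"
      by eventually_elim (rule set_dist_eq_0D[OF finite_orbit[OF p] ne])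
    have "orbit y \<in> sets seq_borel"
      by (rule sets.countable[OF singleton_sets_seq_borel countable_finite[OF finite_orbit[OF p]]])
    then show "measure \<nu> (orbit y) = 1"
      unfolding invariant_probD(2)[OF inv, symmetric] using ae by (simp add: prob_eq_1)
  qed
  then have "{\<nu>. maximizing g \<nu>} = {orbit_measure y}" using max by blast
  then show ?thesis using g by (simp add: uniquely_optimized_def)
qed

text \<open>Half of the penalty \<epsilon> pays for departures from the orbit; the other half is
  kept as the surplus that gives uniqueness. \<eta> is chosen after \<open>y\<close>, since it
  depends on the period.\<close>

lemma locking_perturbation:
  fixes f :: "(nat \<Rightarrow> 'a::finite) \<Rightarrow> real"
  assumes f: "f \<in> lip_space A" and \<epsilon>: "\<epsilon> > 0"
  obtains y \<eta> where "periodic y" "\<eta> > 0"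
    "\<forall>g\<in>lip_space A. lip_norm A (\<lambda>x. (f x - \<epsilon> * set_dist (orbit y) x) - g x) \<le> \<eta>
      \<longrightarrow> g \<in> uniquely_optimized A y"
proof -
  obtain C where C': "\<And>k x y. agree k x y \<Longrightarrow> \<bar>f x - f y\<bar> \<le> C * A k"
    using lip_spaceE[OF pos dec f] by metis
  then have C: "\<forall>k x y. agree k x y \<longrightarrow> \<bar>f x - f y\<bar> \<le> C * A k" by blast
  have "0 \<le> C * A 0" using C'[of 0 undefined undefined] by auto
  then have C0: "C \<ge> 0" using pos[of 0] by (simp add: zero_le_mult_iff)
  obtain \<beta> \<phi> K where sub: "\<forall>x. \<bar>\<phi> x\<bar> \<le> K" "\<forall>x. f x - \<beta> + (\<phi> x - \<phi> (full_shift x)) \<le> 0"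
      "\<forall>k x y. agree k x y \<longrightarrow> \<bar>\<phi> x - \<phi> y\<bar> \<le> C * tail (Suc k)"
      "\<forall>\<delta>>0. \<exists>q z. q \<ge> 1 \<and> (full_shift ^^ q) z = z \<and> birkhoff q f z > real q * (\<beta> - \<delta>)"
    using subaction_exists[OF C] by (elim exE conjE) (rule that)
  note \<phi>K = sub(1)[rule_format]
  have \<phi>var: "\<bar>\<phi> x - \<phi> y\<bar> \<le> C * tail (Suc k)" if "agree k x y" for k x y
    using sub(3) that by blast
  define F where "F x = f x - \<beta> + (\<phi> x - \<phi> (full_shift x))" for x
  have Fneg: "F x \<le> 0" for x using sub(2) by (simp add: F_def)
  have birk_F: "birkhoff n F x = birkhoff n f x - real n * \<beta> + (\<phi> x - \<phi> ((full_shift ^^ n) x))" for n x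
    unfolding F_def[abs_def] birkhoff_plus birkhoff_coboundary
    by (simp add: birkhoff_minus birkhoff_const)
  have Fper: "\<forall>\<delta>>0. \<exists>q z. q \<ge> 1 \<and> (full_shift ^^ q) z = z \<and> birkhoff q F z > - real q * \<delta>"
  proof (intro allI impI)
    fix \<delta> :: real assume \<delta>: "\<delta> > 0"
    obtain q z where q: "q \<ge> 1" "(full_shift ^^ q) z = z" "birkhoff q f z > real q * (\<beta> - \<delta>)"
      using sub(4) \<delta> by blast
    have "birkhoff q F z > - real q * \<delta>"
      using q(3) unfolding birk_F q(2) by (simp add: right_diff_distrib)
    then show "\<exists>q z. q \<ge> 1 \<and> (full_shift ^^ q) z = z \<and> birkhoff q F z > - real q * \<delta>"
      using q by blast
  qed
  \<comment> \<open>1 from \<open>f\<close>, 2 from \<phi>, and 2 from \<phi> after the shift, which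
    loses one symbol and so costs \<open>tail k\<close> instead of
    \<open>tail (Suc k)\<close>.\<close>
  define B where "B = 5 * C"
  have B: "B \<ge> 0" using C0 by (simp add: B_def)
  \<comment> \<open>\<open>6 * B + 4\<close> bounds the coefficient of \<open>A (Suc N)\<close> in
    \<open>small\<close> below, where \<open>s\<close> is \<open>(2 * B + 1) * A (Suc N)\<close> and
    \<open>\<eta> \<le> 1\<close>. This part may use up a quarter of
    \<open>\<epsilon> * A N\<close>.\<close>
  have "\<forall>\<^sub>F N in sequentially. A (Suc N) \<le> \<epsilon> / (4 * (6 * B + 4)) * A N"
    by (rule eventually_ratio_le) (use \<epsilon> B in simp)
  then obtain N1 where N1: "\<And>N. N \<ge> N1 \<Longrightarrow> A (Suc N) \<le> \<epsilon> / (4 * (6 * B + 4)) * A N"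
    by (auto simp: eventually_sequentially)
  obtain N2 where N2: "\<And>k. k \<ge> N2 \<Longrightarrow> tail k \<le> 2 * A k"
    using eventually_tail_le by (auto simp: eventually_sequentially)
  \<comment> \<open>\<open>N\<close> at least 1 ensures \<open>Suc (k - 1) = k\<close> in the
    estimate for \<phi> after the shift.\<close>
  define N where "N = max (max N1 N2) 1"
  have N: "N \<ge> N1" "N \<ge> N2" "N \<ge> 1" by (auto simp: N_def)
  have "(6 * B + 4) * A (Suc N) \<le> (6 * B + 4) * (\<epsilon> / (4 * (6 * B + 4)) * A N)"
    by (rule mult_left_mono[OF N1[OF N(1)]]) (use B in simp)
  also have "\<dots> = \<epsilon> / 4 * A N"
    using B by (simp add: field_simps)
  finally have gap: "(6 * B + 4) * A (Suc N) \<le> \<epsilon> / 4 * A N" .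
  have tailN: "tail (Suc N) \<le> 2 * A (Suc N)" using N2[of "Suc N"] N by simp
  have Fvar: "\<forall>k\<ge>N. \<forall>x y. agree k x y \<longrightarrow> \<bar>F x - F y\<bar> \<le> B * A k"
  proof (intro allI impI)
    fix k and x y :: "nat \<Rightarrow> 'a" assume k: "N \<le> k" and ag: "agree k x y"
    have "agree (k - 1) (full_shift x) (full_shift y)" using ag by (auto simp: full_shift_def)
    then have "\<bar>\<phi> (full_shift x) - \<phi> (full_shift y)\<bar> \<le> C * tail (Suc (k - 1))" by (rule \<phi>var)
    also have "Suc (k - 1) = k" using k N by simp
    finally have 1: "\<bar>\<phi> (full_shift x) - \<phi> (full_shift y)\<bar> \<le> C * tail k" .
    have 2: "C * tail (Suc k) \<le> C * tail k" by (rule mult_left_mono[OF tail_mono C0])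
    have 3: "C * tail k \<le> C * (2 * A k)" by (rule mult_left_mono[OF N2 C0]) (use k N in simp)
    show "\<bar>F x - F y\<bar> \<le> B * A k" 
      using C'[OF ag] \<phi>var[OF ag] 1 2 3 unfolding F_def B_def abs_le_iff by linarith
  qed
  obtain p y where p: "p \<ge> 1" "(full_shift ^^ p) y = y"
    and good: "- (2 * B + 1) * A (Suc N) \<le> birkhoff p F y"
    and sep: "\<forall>a b. agree N ((full_shift ^^ a) y) ((full_shift ^^ b) y)
       \<longrightarrow> (full_shift ^^ a) y = (full_shift ^^ b) y"
    by (rule good_periodic_orbit[of F N B, OF Fneg Fper Fvar B tailN])
  define d where "d = set_dist (orbit y)"
  have ne: "orbit y \<noteq> {}" by (simp add: orbit_def)
  have d_orb: "d ((full_shift ^^ i) y) = 0" for i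
    unfolding d_def by (rule set_dist_eq_0) (simp add: orbit_def)
  \<comment> \<open>The cap 1 is what \<open>6 * B + 4\<close> relies on; the second term limits the
    error along the orbit to another quarter of \<open>\<epsilon> * A N\<close>.\<close>
  define \<eta> where "\<eta> = min 1 (\<epsilon> * A N / (4 * (2 * real p + 2)))"
  have \<eta>: "\<eta> > 0" "\<eta> \<le> 1" using \<epsilon> pos[of N] by (auto simp: \<eta>_def)
  have "(2 * real p + 2) * \<eta> \<le> (2 * real p + 2) * (\<epsilon> * A N / (4 * (2 * real p + 2)))"
    unfolding \<eta>_def by (intro mult_left_mono) auto
  also have "\<dots> = \<epsilon> / 4 * A N" by (simp add: field_simps)
  finally have \<eta>_small: "(2 * real p + 2) * \<eta> \<le> \<epsilon> / 4 * A N" .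
  have "\<eta> * A (Suc N) \<le> 1 * A (Suc N)" using \<eta> pos[of "Suc N"] by (intro mult_right_mono) auto
  then have small: "2 * (B + \<eta>) * A (Suc N) + 2 * ((2 * B + 1) * A (Suc N)) + (2 * real p + 2) * \<eta>
      \<le> \<epsilon> / 2 * A N"
    using gap \<eta>_small by (simp add: algebra_simps)
  have lock: "g \<in> uniquely_optimized A y"
    if g: "g \<in> lip_space A" and norm: "lip_norm A (\<lambda>x. (f x - \<epsilon> * d x) - g x) \<le> \<eta>" for g
  proof -
    define e where "e x = g x - (f x - \<epsilon> * d x)" for x
    have "(\<lambda>x. \<epsilon> * d x) \<in> lip_space A"
    proof (rule lip_spaceI[of _ \<epsilon>])
      fix k and x x' :: "nat \<Rightarrow> 'a" assume "agree k x x'"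
      then have "\<epsilon> * \<bar>d x - d x'\<bar> \<le> \<epsilon> * A k"
        unfolding d_def using \<epsilon> by (intro mult_left_mono set_dist_agree[OF ne]) auto
      then show "\<bar>\<epsilon> * d x - \<epsilon> * d x'\<bar> \<le> \<epsilon> * A k"
        using \<epsilon> by (simp add: abs_mult flip: right_diff_distrib)
    qed
    then have e_lip: "e \<in> lip_space A"
      unfolding e_def[abs_def] by (intro lip_space_diff g f)
    have e_norm: "lip_norm A e \<le> \<eta>"
      using norm lip_norm_minus_commute[of A g "\<lambda>x. f x - \<epsilon> * d x"] by (simp add: e_def[abs_def])
    have e_bdd: "\<bar>e x\<bar> \<le> \<eta>" for x using lip_norm_bounds(1)[OF e_lip, of x] e_norm by linarith
    have evar: "\<bar>e x - e y\<bar> \<le> \<eta> * A k" if "agree k x y" for k x y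
      using lip_norm_bounds(2)[OF e_lip that] mult_right_mono[OF e_norm, of "A k"] pos[of k] by linarith
    \<comment> \<open>The mean of \<open>F + e\<close> over the orbit; with \<beta> added it is the
      mean of \<open>g\<close>, as \<open>d\<close> vanishes there.\<close>
    define c where "c = birkhoff p (\<lambda>x. F x + e x) y / real p"
    have c: "real p * c = birkhoff p (\<lambda>x. F x + e x) y" using p by (simp add: c_def)
    define M where "M = 2 * (B + \<eta>) * A (Suc N) + (2 * B + 1) * A (Suc N) + 2 * real p * \<eta>"
    have bound: "birkhoff n (\<lambda>x. F x - \<epsilon> / 2 * d x + e x - c) x \<le> M" for n x
      unfolding M_def
    proof (rule perturbed_birkhoff_bounded[where F = F and N = N and B = B, OF Fneg Fvar B tailN p])
      show "0 \<le> d x" for x unfolding d_def by (rule set_dist_nonneg[OF ne])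
      show "d x = 0" if "x \<in> orbit y" for x using that d_orb by (auto simp: orbit_def)
      show "A N \<le> d x" if "\<And>a. \<not> agree (Suc N) x ((full_shift ^^ a) y)" for x
        unfolding d_def by (rule set_dist_away[OF ne]) (use that in \<open>auto simp: orbit_def\<close>)
      show "- ((2 * B + 1) * A (Suc N)) \<le> birkhoff p F y" using good by (simp add: algebra_simps)
      show "0 \<le> (2 * B + 1) * A (Suc N)" using B pos[of "Suc N"] by simp
      show "(full_shift ^^ a) y = (full_shift ^^ b) y"
        if "agree N ((full_shift ^^ a) y) ((full_shift ^^ b) y)" for a b using sep that by blast
      show "\<bar>e x\<bar> \<le> \<eta>" for x by (rule e_bdd)
      show "\<bar>e x - e y\<bar> \<le> \<eta> * A k" if "agree k x y" for k x y by (rule evar[OF that])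
      show "0 \<le> \<epsilon> / 2" using \<epsilon> by simp
    qed (fact c small)+
    \<comment> \<open>As \<open>g = f - \<epsilon> * d + e\<close>, charging \<open>F + e\<close>
      only half of the penalty amounts, up to a constant and a coboundary, to adding the other half
      back to \<open>g\<close>.\<close>
    have g2: "(\<lambda>x. F x - \<epsilon> / 2 * d x + e x - c)
        = (\<lambda>x. (g x + \<epsilon> / 2 * d x) - (\<beta> + c) + (\<phi> x - \<phi> (full_shift x)))"
      by (auto simp: F_def e_def algebra_simps)
    have g2_birk: "birkhoff n (\<lambda>x. F x - \<epsilon> / 2 * d x + e x - c) x
      = birkhoff n (\<lambda>x. g x + \<epsilon> / 2 * d x) x - real n * (\<beta> + c) + (\<phi> x - \<phi> ((full_shift ^^ n) x))" for n x
      unfolding g2 birkhoff_plus[of n "\<lambda>x. (g x + \<epsilon> / 2 * d x) - (\<beta> + c)"]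
        birkhoff_minus[of n "\<lambda>x. g x + \<epsilon> / 2 * d x"] birkhoff_const birkhoff_coboundary by simp
    show ?thesis
    proof (rule uniquely_optimizedI[OF p g, of "\<epsilon> / 2" "\<beta> + c" "M + 2 * K"])
      \<comment> \<open>The telescoped coboundary adds at most \<open>2 * K\<close>.\<close>
      show "birkhoff n (\<lambda>x. g x + \<epsilon> / 2 * set_dist (orbit y) x) x \<le> real n * (\<beta> + c) + (M + 2 * K)" for n x
        using bound[of n x] g2_birk[of n x] \<phi>K[of x] \<phi>K[of "(full_shift ^^ n) x"]
        unfolding d_def by (simp add: abs_le_iff)
      have "birkhoff p g y = birkhoff p (\<lambda>x. f x + e x) y"
        unfolding birkhoff_def by (simp add: e_def d_orb)
      also have "\<dots> = real p * (\<beta> + c)"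
        using c by (simp add: birkhoff_plus birk_F p(2) algebra_simps)
      finally show "birkhoff p g y = real p * (\<beta> + c)" .
    qed (use \<epsilon> in simp)
  qed
  show ?thesis
  proof (rule that[of y \<eta>])
    show "periodic y" using p by (auto simp: periodic_def)
    show "\<forall>g\<in>lip_space A. lip_norm A (\<lambda>x. (f x - \<epsilon> * set_dist (orbit y) x) - g x) \<le> \<eta>
      \<longrightarrow> g \<in> uniquely_optimized A y"
      unfolding d_def[symmetric] by (intro ballI impI lock)
  qed (rule \<eta>(1))
qed

end

section \<open>Density of the locked functions\<close>

theorem theorem2:
  fixes A :: "nat \<Rightarrow> real"
  assumes "\<And>n. A n > 0"
    and "decseq A"
    and "A \<longlonglongrightarrow> 0"
    and "(\<lambda>n. A (Suc n) / A n) \<longlonglongrightarrow> 0"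
  shows "lip_topology A closure_of
           (\<Union>y \<in> {y :: nat \<Rightarrow> 'a::finite. periodic y}. lip_topology A interior_of uniquely_optimized A y)
         = lip_space A"
proof -
  interpret superexp A by unfold_locales (fact assms)+
  let ?L = "lip_space A :: ((nat \<Rightarrow> 'a) \<Rightarrow> real) set"
  interpret L: Metric_space ?L "lip_dist A"
    by (rule Metric_space_lip_space[OF assms(1,2)])
  let ?U = "\<Union>y \<in> {y :: nat \<Rightarrow> 'a. periodic y}. lip_topology A interior_of uniquely_optimized A y"
  have "\<exists>h \<in> ?U. h \<in> L.mball f r" if f: "f \<in> ?L" and r: "r > 0" for f r
  proof -
    \<comment> \<open>The distance from the orbit has Lipschitz constant at most 1 and supremum at
      most \<open>A 0\<close>, so the perturbation has norm at most
      \<open>\<epsilon> * (1 + A 0) = r / 2\<close>.\<close>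
    define \<epsilon> where "\<epsilon> = r / 2 / (1 + A 0)"
    have \<epsilon>: "\<epsilon> > 0" using r pos[of 0] by (simp add: \<epsilon>_def)
    obtain y \<eta> where y: "periodic y" and \<eta>: "\<eta> > 0"
      and lock: "\<forall>g\<in>?L. lip_norm A (\<lambda>x. (f x - \<epsilon> * set_dist (orbit y) x) - g x) \<le> \<eta>
        \<longrightarrow> g \<in> uniquely_optimized A y"
      by (rule locking_perturbation[OF f \<epsilon>]) (rule that)
    have ne: "orbit y \<noteq> {}" by (simp add: orbit_def)
    define D where "D x = \<epsilon> * set_dist (orbit y) x" for x
    define h where "h x = f x - D x" for x
    have Dvar: "\<bar>D x - D x'\<bar> \<le> \<epsilon> * A k" if "agree k x x'" for k x x'
      using mult_left_mono[OF set_dist_agree[OF ne that], of \<epsilon>] \<epsilon>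
      by (simp add: D_def abs_mult flip: right_diff_distrib)
    have D_bdd: "\<bar>D x\<bar> \<le> \<epsilon> * A 0" for x
      using mult_left_mono[OF set_dist_bounded[OF ne, of x], of \<epsilon>] \<epsilon> set_dist_nonneg[OF ne, of x]
      by (simp add: D_def abs_mult)
    have h: "h \<in> ?L"
      unfolding h_def[abs_def] by (intro lip_space_diff f lip_spaceI[OF Dvar])
    have "lip_dist A f h = lip_norm A D"
      using f h by (simp add: lip_dist_def h_def)
    also have "\<dots> \<le> \<epsilon> + \<epsilon> * A 0" by (rule lip_norm_le[OF Dvar D_bdd])
    also have "\<dots> = \<epsilon> * (1 + A 0)" by (simp add: distrib_left)
    also have "\<dots> = r / 2"
      using pos[of 0] by (simp add: \<epsilon>_def del: distrib_left_numeral)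
    finally have "h \<in> L.mball f r" using f h r by simp
    \<comment> \<open>Locking holds on a whole ball around \<open>h\<close>, which makes
      \<open>h\<close> an interior point.\<close>
    moreover have "L.mball h \<eta> \<subseteq> uniquely_optimized A y"
    proof
      fix g assume "g \<in> L.mball h \<eta>"
      then show "g \<in> uniquely_optimized A y"
        by (intro lock[rule_format]) (auto simp: lip_dist_def h_def D_def split: if_splits)
    qed
    then have "h \<in> lip_topology A interior_of uniquely_optimized A y"
      using h \<eta> by (auto simp: lip_topology_def L.metric_interior_of)
    ultimately show ?thesis using y by blast
  qed
  then show ?thesis
    unfolding lip_topology_def L.metric_closure_of by blast
qed

end
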